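(* (1) For every integer $q$ with $q=3k$ for some $k\ge 2$, or $q=3k+1$ for some $k\ge 3$, there exist infinitely many pairwise non-isomorphic cyclic $q$-equivelar triangulations of orientable closed surfaces, and infinitely many pairwise non-isomorphic cyclic $q$-equivelar triangulations of non-orientable closed surfaces. (2) Up to combinatorial isomorphism there are exactly two cyclic $7$-equivelar triangulations of closed surfaces. Both have $n=12$ vertices and triangulate the orientable surface of genus $2$; with vertex set $\mathbb{Z}_{12}$ they are generated by the triangles $[0,1,2],[0,2,6],[0,4,8]$ and by $[0,1,5],[0,1,6],[0,4,8]$, respectively.
   Context: For an integer $n\ge 3$ identify a vertex set with $\mathbb{Z}_n=\{0,1,\dots,n-1\}$; integers used as vertices are read modulo $n$. A triangle $[a,b,c]$ is a 3-element subset of $\mathbb{Z}_n$. Its orbit is $\{[a+i,b+i,c+i]: i\in\mathbb{Z}_n\}$. The complex generated by a list of triangles is the pure 2-dimensional simplicial complex whose triangles are the union of the orbits of the listed triangles. A cyclic triangulation with $n$ vertices is a simplicial complex on the vertex set $\mathbb{Z}_n$ that triangulates a closed (compact, connected, boundaryless) surface and is invariant under the shift $i\mapsto i+1$. Equivalently, it is a triangulated closed surface whose automorphism group contains a cyclic subgroup permuting all $n$ vertices in a single cycle. A triangulation is $q$-equivelar if every vertex lies in exactly $q$ triangles. *)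

theory Defs
  imports Main
begin

text \<open>A (pure 2-dimensional) simplicial complex is represented by its set of triangles
  K :: 'a set set; its vertex set is the union of the triangles.\<close>

definition cverts :: "'a set set \<Rightarrow> 'a set" where
  "cverts K = \<Union>K"

definition tri_edges :: "'a set set \<Rightarrow> 'a set set" where
  "tri_edges K = {e. card e = 2 \<and> (\<exists>t\<in>K. e \<subseteq> t)}"

definition link_edges :: "'a set set \<Rightarrow> 'a \<Rightarrow> 'a set set" where
  "link_edges K v = {t - {v} | t. t \<in> K \<and> v \<in> t}"

definition link_connected :: "'a set set \<Rightarrow> 'a \<Rightarrow> bool" where
  "link_connected K v \<longleftrightarrow>
     (\<forall>x\<in>\<Union>(link_edges K v). \<forall>y\<in>\<Union>(link_edges K v).
        (\<lambda>a b. {a, b} \<in> link_edges K v)\<^sup>*\<^sup>* x y)"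

definition skeleton_connected :: "'a set set \<Rightarrow> bool" where
  "skeleton_connected K \<longleftrightarrow>
     (\<forall>x\<in>cverts K. \<forall>y\<in>cverts K. (\<lambda>a b. {a, b} \<in> tri_edges K)\<^sup>*\<^sup>* x y)"

text \<open>K triangulates a closed (compact, connected, boundaryless) surface: finite pure
  2-dimensional complex, every edge in exactly two triangles, every vertex link is a single
  cycle (the link is 2-regular by the edge condition, so connectedness makes it one cycle),
  and the complex is connected.\<close>
definition closed_surface :: "'a set set \<Rightarrow> bool" where
  "closed_surface K \<longleftrightarrow>
     K \<noteq> {} \<and> finite (cverts K) \<and> (\<forall>t\<in>K. card t = 3) \<and>
     (\<forall>e\<in>tri_edges K. card {t\<in>K. e \<subseteq> t} = 2) \<and>
     (\<forall>v\<in>cverts K. link_connected K v) \<and>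
     skeleton_connected K"

definition shift :: "nat \<Rightarrow> nat \<Rightarrow> nat \<Rightarrow> nat" where
  "shift n i x = (x + i) mod n"

definition cyclic_triangulation :: "nat \<Rightarrow> nat set set \<Rightarrow> bool" where
  "cyclic_triangulation n K \<longleftrightarrow>
     3 \<le> n \<and> cverts K = {0..<n} \<and> closed_surface K \<and>
     (\<forall>t\<in>K. shift n 1 ` t \<in> K)"

definition equivelar :: "nat \<Rightarrow> 'a set set \<Rightarrow> bool" where
  "equivelar q K \<longleftrightarrow> (\<forall>v\<in>cverts K. card {t\<in>K. v \<in> t} = q)"

definition generated :: "nat \<Rightarrow> nat set list \<Rightarrow> nat set set" where
  "generated n ts = {shift n i ` t | t i. t \<in> set ts \<and> i < n}"

definition iso :: "'a set set \<Rightarrow> 'b set set \<Rightarrow> bool" where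
  "iso K L \<longleftrightarrow> (\<exists>f. bij_betw f (cverts K) (cverts L) \<and> (\<lambda>t. f ` t) ` K = L)"

text \<open>Orientability: each triangle receives an ordering (a,b,c) (representing the cyclic
  orientation), and two distinct triangles never induce the same directed edge, i.e. the two
  triangles at each edge induce opposite orientations on it.\<close>
definition dir_edges :: "'a \<times> 'a \<times> 'a \<Rightarrow> ('a \<times> 'a) set" where
  "dir_edges p = (case p of (a, b, c) \<Rightarrow> {(a, b), (b, c), (c, a)})"

definition orientable :: "'a set set \<Rightarrow> bool" where
  "orientable K \<longleftrightarrow>
     (\<exists>\<sigma>. (\<forall>t\<in>K. (case \<sigma> t of (a, b, c) \<Rightarrow> {a, b, c} = t)) \<and>
          (\<forall>t\<in>K. \<forall>t'\<in>K. t \<noteq> t' \<longrightarrow> dir_edges (\<sigma> t) \<inter> dir_edges (\<sigma> t') = {}))"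

definition euler_char :: "'a set set \<Rightarrow> int" where
  "euler_char K = int (card (cverts K)) - int (card (tri_edges K)) + int (card K)"

end

theory Submission
  imports Defs "HOL-Number_Theory.Cong"
begin

text \<open>A cyclic complex is determined by the link of the vertex 0: a base triangle \<open>{0, a, b}\<close> contributes
  the link edges \<open>{a, b}\<close>, \<open>{b - a, -a}\<close> and \<open>{-b, a - b}\<close> modulo \<open>n\<close>, and the complex is a closed
  surface of degree \<open>q\<close> iff these edges form a cycle of length \<open>q\<close> whose vertices generate the integers
  modulo \<open>n\<close>.

  For the families, triangulate the polygon with side word \<open>x\<^sub>0 x\<^sub>0 x\<^sub>1 x\<^sub>1 \<dots> x\<^sub>g x\<^sub>g y y\<close> by its diagonals from one
  corner, where \<open>x\<^sub>i = 3 ^ i\<close> and \<open>y\<close> is a large parameter, and label the corners by partial sums. The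
  polygon either closes up (\<open>n\<close> is the total) or has one more side \<open>n/2\<close>, one more side \<open>n/3\<close> resp. \<open>2n/3\<close>
  carrying the short orbit, or both; this gives degrees \<open>6g + 6, 6g + 9, 6g + 10, 6g + 13\<close>. As each
  side occurs twice in the same direction, the complex is orientable iff the shift can reverse the
  orientation, which happens iff \<open>y\<close> is odd.

  In degree 7 the rotation \<open>(a, b) \<mapsto> (b - a, -a)\<close> of the 14 ordered link edges has a fixed point, and so
  has negation on the 7 link vertices. Hence \<open>n = 6m\<close>, with \<open>2m\<close>, \<open>4m\<close> adjacent in the link and \<open>3m\<close> a vertex
  of it. The rotation then determines the link up to multiples of \<open>m/2\<close>, so connectedness
  forces \<open>n = 12\<close>; the eight remaining links are exchanged by multiplication with units modulo 12.\<close>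

section \<open>Directed cycles and differences modulo n\<close>

fun arcs :: "'a list \<Rightarrow> ('a \<times> 'a) set" where
  "arcs (x # y # zs) = insert (x, y) (arcs (y # zs))"
| "arcs _ = {}"

definition cyc :: "'a list \<Rightarrow> ('a \<times> 'a) set" where
  "cyc cs = {(cs ! i, cs ! (Suc i mod length cs)) | i. i < length cs}"

lemma arcs_append:
  "xs \<noteq> [] \<Longrightarrow> ys \<noteq> [] \<Longrightarrow> arcs (xs @ ys) = arcs xs \<union> {(last xs, hd ys)} \<union> arcs ys"
proof (induction xs rule: arcs.induct)
  case ("2_2" v)
  then show ?case by (cases ys) auto
qed auto

lemma arcs_nth: "arcs xs = {(xs ! i, xs ! Suc i) | i. Suc i < length xs}"
proof (induction xs rule: arcs.induct)
  case (1 x y zs)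
  have "{((x # y # zs) ! i, (x # y # zs) ! Suc i) | i. Suc i < length (x # y # zs)}
      = insert (x, y) {((y # zs) ! i, (y # zs) ! Suc i) | i. Suc i < length (y # zs)}" (is "?A = ?B")
  proof
    show "?A \<subseteq> ?B"
    proof
      fix p assume "p \<in> ?A"
      then obtain i where "p = ((x # y # zs) ! i, (x # y # zs) ! Suc i)" "Suc i < length (x # y # zs)"
        by blast
      then show "p \<in> ?B" by (cases i) auto
    qed
    show "?B \<subseteq> ?A" by (auto intro: exI[of _ 0] exI[of _ "Suc i" for i])
  qed
  with 1 show ?case by simp
qed auto

lemma cyc_arcs: "cs \<noteq> [] \<Longrightarrow> cyc cs = insert (last cs, hd cs) (arcs cs)"
proof -
  assume ne: "cs \<noteq> []"
  let ?L = "length cs"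
  have "cyc cs = (\<lambda>i. (cs ! i, cs ! (Suc i mod ?L))) ` {..<?L}"
    unfolding cyc_def by auto
  also have "{..<?L} = insert (?L - 1) {..<?L - 1}" using ne by (cases ?L) auto
  also have "(\<lambda>i. (cs ! i, cs ! (Suc i mod ?L))) ` insert (?L - 1) {..<?L - 1}
      = insert (cs ! (?L - 1), cs ! 0) ((\<lambda>i. (cs ! i, cs ! Suc i)) ` {..<?L - 1})"
    using ne by (auto simp: image_iff)
  also have "\<dots> = insert (last cs, hd cs) (arcs cs)"
    unfolding arcs_nth using ne by (auto simp: last_conv_nth hd_conv_nth image_iff)
  finally show ?thesis .
qed

text \<open>The residue of \<open>b - a\<close>. \<open>n\<close> is added before subtracting, which
  keeps truncated subtraction exact for \<open>a \<le> n\<close>.\<close>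

definition dif :: "nat \<Rightarrow> nat \<Rightarrow> nat \<Rightarrow> nat" where
  "dif n a b = (n + b - a) mod n"

lemma dif_le: "a \<le> b \<Longrightarrow> b < n \<Longrightarrow> dif n a b = b - a"
  unfolding dif_def using mod_add_self2[of "b - a" n] by (simp add: add.commute)

lemma dif_gt: "b < a \<Longrightarrow> a \<le> n \<Longrightarrow> dif n a b = n + b - a"
  unfolding dif_def by (simp add: less_diff_conv)

lemma add_dif_mod: "a \<le> n \<Longrightarrow> (v + a + dif n a b) mod n = (v + b) mod n"
proof -
  assume "a \<le> n"
  then have "v + a + (n + b - a) = v + b + n" by simp
  then show ?thesis unfolding dif_def by (metis mod_add_right_eq mod_add_self2)
qed

lemma add_mod_inj: "x < n \<Longrightarrow> y < n \<Longrightarrow> ((v + x) mod n = (v + y) mod n) = (x = (y::nat))"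
  using cong_add_lcancel_nat[of v x y n] by (auto simp: cong_def)

lemma add_mod_neq: "0 < x \<Longrightarrow> x < n \<Longrightarrow> v < n \<Longrightarrow> (v + x) mod n \<noteq> (v::nat)"
  using add_mod_inj[of x n 0 v] by simp

lemma add_dif_eq: "v < n \<Longrightarrow> w < n \<Longrightarrow> (v + dif n v w) mod n = w"
  using add_dif_mod[of v n 0 w] by simp

lemma dif_lt: "0 < n \<Longrightarrow> dif n v w < n"
  by (simp add: dif_def)

section \<open>Complexes all of whose links are translates of one cycle\<close>

text \<open>\<open>rooted\<close> makes the star of every vertex \<open>v\<close> the cone over the
  cycle \<open>cs\<close> translated by \<open>v\<close>. Shift invariance, two triangles per edge
  and connected links follow from these assumptions; connectedness of the whole complex is obtained
  below from \<open>1 \<in> set cs\<close>.\<close>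

locale cyclic_link =
  fixes n :: nat and K :: "nat set set" and cs :: "nat list"
  assumes len: "3 \<le> length cs" and dist: "distinct cs" and range: "set cs \<subseteq> {1..<n}"
    and verts: "\<And>t. t \<in> K \<Longrightarrow> t \<noteq> {} \<and> t \<subseteq> {..<n}"
    and rooted: "\<And>v t. v < n \<Longrightarrow> t \<in> K \<and> v \<in> t \<longleftrightarrow>
      (\<exists>(x, y) \<in> cyc cs. t = {v, (v + x) mod n, (v + y) mod n})"
begin

abbreviation "L \<equiv> length cs"

text \<open>Indices are read modulo \<open>L\<close>, so the successor along the cycle is plain
  \<open>Suc\<close>, with no wrap-around case.\<close>

definition c :: "nat \<Rightarrow> nat" where "c i = cs ! (i mod L)"

definition tri :: "nat \<Rightarrow> nat \<Rightarrow> nat set" where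
  "tri v i = {v, (v + c i) mod n, (v + c (Suc i)) mod n}"

lemma L_pos: "0 < L" using len by auto

lemma c_inj: "c i = c j \<longleftrightarrow> i mod L = j mod L"
  unfolding c_def using dist L_pos by (simp add: nth_eq_iff_index_eq)

lemma c_mod: "c (i mod L) = c i" by (simp add: c_def)

lemma c_Suc_mod: "c (Suc (i mod L)) = c (Suc i)"
  by (simp add: c_inj mod_Suc_eq)

lemma c_in: "c i \<in> set cs"
  unfolding c_def using L_pos by simp

lemma c_range: "0 < c i" "c i < n"
  using c_in[of i] range by auto

lemma n_pos: "0 < n" using c_range[of 0] by simp

lemma in_cs: "x \<in> set cs \<longleftrightarrow> (\<exists>i<L. x = c i)"
  by (auto simp: in_set_conv_nth c_def)

lemma cyc_c: "cyc cs = {(c i, c (Suc i)) | i. i < L}"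
proof -
  have "(cs ! i, cs ! (Suc i mod L)) = (c i, c (Suc i))" if "i < L" for i
    using that by (simp add: c_def)
  then show ?thesis unfolding cyc_def by (metis (no_types, lifting))
qed

lemma Suc_mod_inj: "Suc i mod L = Suc j mod L \<longleftrightarrow> i mod L = j mod L"
  using cong_add_rcancel_nat[of i 1 j L] by (simp add: cong_def)

lemma mod_Suc_neq: "i mod L \<noteq> Suc i mod L" "i mod L \<noteq> Suc (Suc i) mod L"
  using len by (auto simp: mod_Suc split: if_splits)

lemma shift_c_inj: "(v + c i) mod n = (v + c j) mod n \<longleftrightarrow> i mod L = j mod L"
  using add_mod_inj[of "c i" n "c j" v] c_range by (simp add: c_inj)

lemma shift_c_neq: "v < n \<Longrightarrow> (v + c i) mod n \<noteq> v"
  using add_mod_neq c_range by blast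

lemma tri_mod: "tri v (i mod L) = tri v i"
  by (simp add: tri_def c_mod c_Suc_mod)

lemma tri_iff: "v < n \<Longrightarrow> t \<in> K \<and> v \<in> t \<longleftrightarrow> (\<exists>i<L. t = tri v i)"
  by (subst rooted) (auto simp: cyc_c tri_def)

lemma tri_in: "v < n \<Longrightarrow> tri v i \<in> K"
  using tri_iff[of v "tri v i"] tri_mod[of v i] L_pos by (metis mod_less_divisor)

lemma tri_inj: "v < n \<Longrightarrow> tri v i = tri v j \<longleftrightarrow> i mod L = j mod L"
proof
  assume v: "v < n" and eq: "tri v i = tri v j"
  have "{(v + c i) mod n, (v + c (Suc i)) mod n} = {(v + c j) mod n, (v + c (Suc j)) mod n}"
    using eq shift_c_neq[OF v] unfolding tri_def by (metis insert_ident insertE singletonD)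
  then have "i mod L = j mod L \<or> (i mod L = Suc j mod L \<and> Suc i mod L = j mod L)"
    unfolding doubleton_eq_iff shift_c_inj by blast
  \<comment> \<open>A reversed match of the two link edges would make \<open>i\<close> and
    \<open>i + 2\<close> congruent modulo \<open>L\<close>, against
    \<open>3 \<le> L\<close>.\<close>
  moreover have "\<not> (i mod L = Suc j mod L \<and> Suc i mod L = j mod L)"
    using Suc_mod_inj mod_Suc_neq(2) by metis
  ultimately show "i mod L = j mod L" by blast
next
  assume "i mod L = j mod L"
  then show "tri v i = tri v j" using tri_mod by metis
qed

lemma star_eq: "v < n \<Longrightarrow> {t \<in> K. v \<in> t} = tri v ` {..<L}"
  using tri_iff by (auto simp: image_iff)

lemma card_star: "v < n \<Longrightarrow> card {t \<in> K. v \<in> t} = L"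
  unfolding star_eq by (subst card_image) (auto simp: inj_on_def tri_inj)

lemma verts_eq: "cverts K = {0..<n}"
proof -
  have "v \<in> \<Union>K" if "v < n" for v
    using tri_in[OF that, of 0] by (auto simp: tri_def)
  then show ?thesis unfolding cverts_def using verts by (fastforce simp: atLeast0LessThan)
qed

lemma tri_cover: "t \<in> K \<Longrightarrow> \<exists>v i. v < n \<and> i < L \<and> t = tri v i"
  using verts[of t] tri_iff by (metis ex_in_conv lessThan_iff subsetD)

lemma tri_card: "v < n \<Longrightarrow> card (tri v i) = 3"
  using shift_c_neq[of v] mod_Suc_neq(1)[of i] by (auto simp: tri_def shift_c_inj card_insert_if) metis+

text \<open>An edge at \<open>v\<close> is a vertex of the link cycle, and such a vertex lies on
  just the two consecutive link edges around it.\<close>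

lemma edge_star:
  assumes v: "v < n" and e: "e \<in> tri_edges K" "v \<in> e"
  obtains i where "e = {v, (v + c (Suc i)) mod n}"
    "{t \<in> K. e \<subseteq> t} = {tri v i, tri v (Suc i)}"
proof -
  from e obtain w t where w: "e = {v, w}" "w \<noteq> v" "e \<subseteq> t" "t \<in> K"
    unfolding tri_edges_def card_2_iff by blast
  then obtain j where j: "t = tri v j" using tri_iff[OF v, of t] by auto
  then have "w = (v + c j) mod n \<or> w = (v + c (Suc j)) mod n"
    using w by (auto simp: tri_def)
  \<comment> \<open>One place back on the cycle is \<open>L - 1\<close> places forward, so either
    end of the link edge has an index of the form \<open>Suc i\<close>.\<close>
  moreover have "c j = c (Suc (j + L - 1))" using L_pos by (simp add: c_inj)
  ultimately obtain i where i: "w = (v + c (Suc i)) mod n" by metis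
  have "e \<subseteq> tri v k \<longleftrightarrow> k mod L = i mod L \<or> k mod L = Suc i mod L" for k
    using shift_c_neq[OF v] w(1) i
    by (auto simp: tri_def shift_c_inj Suc_mod_inj)
  then have "e \<subseteq> tri v k \<longleftrightarrow> tri v k = tri v i \<or> tri v k = tri v (Suc i)" for k
    using tri_inj[OF v] by blast
  moreover have "t \<in> K \<and> e \<subseteq> t \<Longrightarrow> \<exists>k. t = tri v k" for t
    using tri_iff[OF v, of t] w(1) by auto
  ultimately have "{t \<in> K. e \<subseteq> t} = {tri v i, tri v (Suc i)}"
    using tri_in[OF v] by blast
  then show thesis using that w(1) i by blast
qed

lemma link_edges_eq: "v < n \<Longrightarrow> link_edges K v = {{(v + c i) mod n, (v + c (Suc i)) mod n} | i. i < L}"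
proof -
  assume v: "v < n"
  have "link_edges K v = {t - {v} | t. \<exists>i<L. t = tri v i}"
    unfolding link_edges_def using tri_iff[OF v] by auto
  also have "\<dots> = {tri v i - {v} | i. i < L}" by blast
  moreover have "tri v i - {v} = {(v + c i) mod n, (v + c (Suc i)) mod n}" for i
    using shift_c_neq[OF v] by (auto simp: tri_def)
  ultimately show ?thesis by simp
qed

lemma link_conn: "v < n \<Longrightarrow> link_connected K v"
proof -
  assume v: "v < n"
  let ?R = "\<lambda>a b. {a, b} \<in> link_edges K v" and ?d = "\<lambda>i. (v + c i) mod n"
  have step: "?R (?d i) (?d (Suc i))" for i
  proof -
    have "{?d (i mod L), ?d (Suc (i mod L))} \<in> link_edges K v"
      unfolding link_edges_eq[OF v] using L_pos by auto
    then show ?thesis by (simp add: c_mod c_Suc_mod)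
  qed
  have path: "?R\<^sup>*\<^sup>* (?d i) (?d (i + k))" for i k
    by (induction k) (auto intro: rtranclp.rtrancl_into_rtrancl step)
  have conn: "?R\<^sup>*\<^sup>* (?d i) (?d j)" for i j
  proof -
    \<comment> \<open>\<open>path\<close> only moves forward; \<open>j + i * L\<close> names the
      same point as \<open>j\<close> and is not below \<open>i\<close>.\<close>
    have "i \<le> i * L" using L_pos by (cases L) auto
    then have "i + (j + i * L - i) = j + i * L" by linarith
    then have "c (i + (j + i * L - i)) = c j" by (simp add: c_inj)
    then show ?thesis using path[of i "j + i * L - i"] by simp
  qed
  have "x \<in> range ?d" if "x \<in> \<Union>(link_edges K v)" for x
    using that unfolding link_edges_eq[OF v] by auto
  then show ?thesis unfolding link_connected_def using conn by blast
qed

text \<open>With \<open>1\<close> in the link every \<open>v\<close> is joined to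
  \<open>v + 1\<close>, and these edges run through all residues.\<close>

lemma skeleton_conn: "1 \<in> set cs \<Longrightarrow> skeleton_connected K"
proof -
  assume "1 \<in> set cs"
  then obtain i where i: "c i = 1" using in_cs by metis
  let ?R = "\<lambda>a b. {a, b} \<in> tri_edges K"
  have step: "?R v (Suc v mod n)" if "v < n" for v
  proof -
    have "Suc v mod n \<noteq> v" using shift_c_neq[OF that, of i] i by simp
    moreover have "{v, Suc v mod n} \<subseteq> tri v i" by (auto simp: tri_def i)
    ultimately show ?thesis unfolding tri_edges_def using tri_in[OF that, of i] by (auto simp: card_2_iff)
  qed
  have path: "?R\<^sup>*\<^sup>* (v mod n) ((v + k) mod n)" for v k
  proof (induction k)
    case (Suc k)
    have "?R ((v + k) mod n) ((v + Suc k) mod n)"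
      using step[of "(v + k) mod n"] n_pos by (simp add: mod_Suc_eq)
    with Suc show ?case by (rule rtranclp.rtrancl_into_rtrancl)
  qed auto
  have "?R\<^sup>*\<^sup>* v w" if "v < n" "w < n" for v w
    using path[of v "n + w - v"] that by simp
  then show ?thesis unfolding skeleton_connected_def verts_eq by simp
qed

lemma shift_closed: "t \<in> K \<Longrightarrow> shift n 1 ` t \<in> K"
proof -
  assume "t \<in> K"
  then obtain v i where t: "v < n" "t = tri v i" using tri_cover by blast
  have "shift n 1 ` t = tri (Suc v mod n) i"
    unfolding t tri_def shift_def by (simp add: mod_Suc_eq mod_add_left_eq)
  then show ?thesis using tri_in n_pos by simp
qed

lemma two_triangles:
  assumes e: "e \<in> tri_edges K"
  shows "card {t \<in> K. e \<subseteq> t} = 2"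
proof -
  obtain v where v: "v \<in> e" "v < n"
    using e verts unfolding tri_edges_def card_2_iff by blast
  obtain i where "{t \<in> K. e \<subseteq> t} = {tri v i, tri v (Suc i)}"
    using edge_star[OF v(2) e v(1)] by metis
  moreover have "tri v i \<noteq> tri v (Suc i)" using tri_inj[OF v(2)] mod_Suc_neq(1) by metis
  ultimately show ?thesis by simp
qed

theorem cyclic_equivelar:
  assumes "1 \<in> set cs"
  shows "cyclic_triangulation n K" "equivelar L K"
proof -
  have "L \<le> card {1..<n}" using card_mono[OF _ range] distinct_card[OF dist] by simp
  then have n: "3 \<le> n" using len by simp
  have "closed_surface K"
    unfolding closed_surface_def
    using tri_in[of 0 0] n tri_cover tri_card two_triangles link_conn skeleton_conn[OF assms]
    by (auto simp: verts_eq)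
  then show "cyclic_triangulation n K"
    unfolding cyclic_triangulation_def using n verts_eq shift_closed by simp
  show "equivelar L K"
    unfolding equivelar_def verts_eq using card_star by simp
qed

end

section \<open>Base triangles with orientation flags\<close>

lemma card_3_distinct: "card {u, v, w} = 3 \<Longrightarrow> u \<noteq> v \<and> v \<noteq> w \<and> u \<noteq> w"
  by (auto simp: card_insert_if split: if_splits)

lemma triple_cases:
  assumes "{x, y, z} = {u, v, w}" "card {u, v, w} = 3"
  shows "(x, y, z) \<in> {(u, v, w), (v, w, u), (w, u, v), (v, u, w), (u, w, v), (w, v, u)}"
proof -
  have "x \<in> {u, v, w}" "y \<in> {u, v, w}" "z \<in> {u, v, w}"
    by (subst assms(1)[symmetric], simp)+
  moreover have "x \<noteq> y" "y \<noteq> z" "x \<noteq> z"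
    using card_3_distinct[of x y z] assms by metis+
  ultimately show ?thesis by (simp only: insert_iff empty_iff) metis
qed

lemma dir_edges_triple:
  assumes "(x, y, z) \<in> {(u, v, w), (v, w, u), (w, u, v), (v, u, w), (u, w, v), (w, v, u)}"
    and "u \<noteq> v" "v \<noteq> w" "u \<noteq> w"
  shows "(u, v) \<in> dir_edges (x, y, z) \<longleftrightarrow> (v, u) \<notin> dir_edges (x, y, z)"
    "(u, v) \<in> dir_edges (x, y, z) \<longleftrightarrow> (w, u) \<in> dir_edges (x, y, z)"
    "(u, v) \<in> dir_edges (x, y, z) \<longleftrightarrow> (v, w) \<in> dir_edges (x, y, z)"
  using assms by (auto simp: dir_edges_def)

text \<open>The entry \<open>(a, b, sa, sb)\<close> stands for the triangle \<open>{0, a, b}\<close>, oriented as \<open>0, a, b\<close>. Seen from \<open>a\<close> and from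
  \<open>b\<close> the triangle contributes two further arcs to the link; the flags \<open>sa\<close> and \<open>sb\<close> tell whether these
  run against the orientation.\<close>
fun base_tri :: "nat \<times> nat \<times> bool \<times> bool \<Rightarrow> nat set" where
  "base_tri (a, b, sa, sb) = {0, a, b}"

fun item_arcs :: "nat \<Rightarrow> nat \<times> nat \<times> bool \<times> bool \<Rightarrow> (nat \<times> nat) set" where
  "item_arcs n (a, b, sa, sb) =
     {(a, b),
      if sa then (n - a, dif n a b) else (dif n a b, n - a),
      if sb then (dif n b a, n - b) else (n - b, dif n b a)}"

text \<open>The finite check behind each example: with suitable flags the arcs of the base triangles
  are exactly those of one directed cycle \<open>cs\<close>, which then is the link of 0. As
  \<open>base_arcs\<close> compares sets, a triangle with a short orbit, whose three arcs coincide,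
  needs no special treatment.\<close>

locale signed_base =
  fixes n :: nat and its :: "(nat \<times> nat \<times> bool \<times> bool) list" and cs :: "nat list"
  assumes base_len: "3 \<le> length cs" and base_dist: "distinct cs"
    and base_range: "set cs \<subseteq> {1..<n}"
    and base_arcs: "(\<Union>it\<in>set its. item_arcs n it) = cyc cs"
begin

abbreviation "K \<equiv> generated n (map base_tri its)"

lemma item_cyc: "it \<in> set its \<Longrightarrow> p \<in> item_arcs n it \<Longrightarrow> p \<in> cyc cs"
  using base_arcs by blast

lemma item_subset: "it \<in> set its \<Longrightarrow> item_arcs n it \<subseteq> cyc cs"
  using item_cyc by blast

lemma item_range: "(a, b, sa, sb) \<in> set its \<Longrightarrow> 0 < a \<and> a < n \<and> 0 < b \<and> b < n"
proof -
  assume "(a, b, sa, sb) \<in> set its"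
  then have "(a, b) \<in> cyc cs" by (rule item_cyc) simp
  then obtain i where "i < length cs" "a = cs ! i" "b = cs ! (Suc i mod length cs)"
    unfolding cyc_def by blast
  moreover from this(1) have "Suc i mod length cs < length cs" by (cases "length cs") simp_all
  ultimately have "a \<in> set cs" "b \<in> set cs" by simp_all
  then show ?thesis using base_range by auto
qed

lemma shift_base: "i < n \<Longrightarrow> shift n i ` base_tri (a, b, sa, sb) = {i, (i + a) mod n, (i + b) mod n}"
  by (simp add: shift_def add.commute)

lemma K_cases:
  assumes "t \<in> K"
  obtains a b sa sb i where "(a, b, sa, sb) \<in> set its" "i < n"
    "t = {i, (i + a) mod n, (i + b) mod n}"
proof -
  obtain it i where "it \<in> set its" "i < n" "t = shift n i ` base_tri it"
    using assms unfolding generated_def by auto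
  moreover obtain a b sa sb where "it = (a, b, sa, sb)" by (cases it)
  ultimately show thesis using that shift_base by metis
qed

lemma K_intro:
  assumes "(a, b, sa, sb) \<in> set its" "i < n"
  shows "{i, (i + a) mod n, (i + b) mod n} \<in> K"
proof -
  have "base_tri (a, b, sa, sb) \<in> set (map base_tri its)"
    unfolding set_map using assms(1) by (rule imageI)
  then show ?thesis unfolding generated_def using assms(2) shift_base by blast
qed

lemma add_sub_mod:
  assumes "a \<le> n" "i < n"
  shows "((i + a) mod n + (n - a)) mod n = i" "((i + (n - a)) mod n + a) mod n = i"
proof -
  have "i + a + (n - a) = i + n" "i + (n - a) + a = i + n" using assms(1) by simp_all
  then show "((i + a) mod n + (n - a)) mod n = i" "((i + (n - a)) mod n + a) mod n = i"
    unfolding mod_add_left_eq using assms(2) by simp_all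
qed

lemma add_dif_mod': "a \<le> n \<Longrightarrow> ((i + a) mod n + dif n a b) mod n = (i + b) mod n"
  using add_dif_mod by (simp add: mod_add_left_eq)

lemma K_verts: "t \<in> K \<Longrightarrow> t \<noteq> {} \<and> t \<subseteq> {..<n}"
  by (erule K_cases) auto

text \<open>A vertex \<open>v\<close> of a translate of \<open>{0, a, b}\<close> plays the role of
  0, of \<open>a\<close> or of \<open>b\<close>; moving \<open>v\<close> to 0 gives the three link
  edges of the item in turn.\<close>

lemma K_rooted:
  assumes v: "v < n"
  shows "t \<in> K \<and> v \<in> t \<longleftrightarrow> (\<exists>(x, y) \<in> cyc cs. t = {v, (v + x) mod n, (v + y) mod n})"
proof -
  let ?T = "\<lambda>x y. {v, (v + x) mod n, (v + y) mod n}"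
  show ?thesis
  proof
    assume t: "t \<in> K \<and> v \<in> t"
    obtain a b sa sb i where it: "(a, b, sa, sb) \<in> set its" and i: "i < n"
      "t = {i, (i + a) mod n, (i + b) mod n}" using conjunct1[OF t] by (rule K_cases)
    have r: "a < n" "b < n" using item_range[OF it] by auto
    have arcs: "(a, b) \<in> cyc cs" "(n - a, dif n a b) \<in> cyc cs \<or> (dif n a b, n - a) \<in> cyc cs"
      "(n - b, dif n b a) \<in> cyc cs \<or> (dif n b a, n - b) \<in> cyc cs"
      using item_subset[OF it] by (auto split: if_splits)
    have wit: "\<exists>(x, y) \<in> cyc cs. t = ?T x y" if "(x, y) \<in> cyc cs" "t = ?T x y" for x y
      using that by (intro bexI[of _ "(x, y)"]) auto
    consider "v = i" | "v = (i + a) mod n" | "v = (i + b) mod n" using t i by blast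
    then show "\<exists>(x, y) \<in> cyc cs. t = ?T x y"
    proof cases
      case 1 then show ?thesis using arcs(1) i by (intro wit[of a b]) simp_all
    next
      case 2
      have "(v + (n - a)) mod n = i" "(v + dif n a b) mod n = (i + b) mod n"
        unfolding 2 using i r by (intro add_sub_mod add_dif_mod'; simp)+
      then have "t = ?T (n - a) (dif n a b)" "t = ?T (dif n a b) (n - a)"
        using i 2 by (simp_all add: insert_commute)
      then show ?thesis using arcs(2) wit[of "n - a" "dif n a b"] wit[of "dif n a b" "n - a"] by argo
    next
      case 3
      have "(v + (n - b)) mod n = i" "(v + dif n b a) mod n = (i + a) mod n"
        unfolding 3 using i r by (intro add_sub_mod add_dif_mod'; simp)+
      then have "t = ?T (n - b) (dif n b a)" "t = ?T (dif n b a) (n - b)"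
        using i 3 by (simp_all add: insert_commute)
      then show ?thesis using arcs(3) wit[of "n - b" "dif n b a"] wit[of "dif n b a" "n - b"] by argo
    qed
  next
    assume "\<exists>(x, y) \<in> cyc cs. t = ?T x y"
    then obtain x y where xy: "(x, y) \<in> cyc cs" "t = ?T x y" by blast
    then have "(x, y) \<in> (\<Union>it\<in>set its. item_arcs n it)" using base_arcs by simp
    then obtain it where it': "it \<in> set its" "(x, y) \<in> item_arcs n it" by (rule UN_E)
    obtain a b sa sb where "it = (a, b, sa, sb)" by (cases it)
    with it' have it: "(a, b, sa, sb) \<in> set its" "(x, y) \<in> item_arcs n (a, b, sa, sb)" by simp_all
    have r: "a < n" "b < n" using item_range[OF it(1)] by auto
    \<comment> \<open>\<open>ia\<close> and \<open>ib\<close> are where the vertex 0 of the base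
      triangle goes when \<open>v\<close> plays the role of \<open>a\<close> or of
      \<open>b\<close>.\<close>
    define ia where "ia = (v + (n - a)) mod n"
    define ib where "ib = (v + (n - b)) mod n"
    have i: "ia < n" "ib < n" using v unfolding ia_def ib_def by auto
    have "{x, y} = {a, b} \<or> {x, y} = {n - a, dif n a b} \<or> {x, y} = {n - b, dif n b a}"
      using it(2) by (auto split: if_splits)
    moreover have "t = insert v ((\<lambda>x. (v + x) mod n) ` {x, y})" using xy(2) by simp
    ultimately consider "t = ?T a b" | "t = ?T (n - a) (dif n a b)" | "t = ?T (n - b) (dif n b a)"
      by (elim disjE) simp_all
    then show "t \<in> K \<and> v \<in> t"
    proof cases
      case 1 then show ?thesis using K_intro[OF it(1) v] by simp
    next
      case 2
      have e: "(ia + a) mod n = v" "(v + dif n a b) mod n = (ia + b) mod n"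
        using r v add_dif_mod'[of a ia b] add_sub_mod(2)[of a v] by (simp_all add: ia_def)
      then have "t = {ia, (ia + a) mod n, (ia + b) mod n}" using 2 e unfolding ia_def[symmetric] by (simp add: insert_commute)
      then show ?thesis using K_intro[OF it(1) i(1)] e(1) by simp
    next
      case 3
      have e: "(ib + b) mod n = v" "(v + dif n b a) mod n = (ib + a) mod n"
        using r v add_dif_mod'[of b ib a] add_sub_mod(2)[of b v] by (simp_all add: ib_def)
      then have "t = {ib, (ib + a) mod n, (ib + b) mod n}" using 3 e unfolding ib_def[symmetric] by (simp add: insert_commute)
      then show ?thesis using K_intro[OF it(1) i(2)] e(1) by simp
    qed
  qed
qed

sublocale cyclic_link n K cs
  using base_len base_dist base_range K_verts K_rooted by (rule cyclic_link.intro)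

lemma cyc_out: "(x, y) \<in> cyc cs \<Longrightarrow> (x, z) \<in> cyc cs \<Longrightarrow> y = z"
  unfolding cyc_c by (auto simp: c_inj Suc_mod_inj)

lemma cyc_in: "(y, x) \<in> cyc cs \<Longrightarrow> (z, x) \<in> cyc cs \<Longrightarrow> y = z"
  unfolding cyc_c by (auto simp: c_inj Suc_mod_inj)

lemma cyc_range: "(x, y) \<in> cyc cs \<Longrightarrow> 0 < x \<and> x < n \<and> 0 < y \<and> y < n"
  unfolding cyc_c using c_range by auto

text \<open>Reversal at odd vertices. It serves twice: for the arcs of an item whose flags are
  parities, and for the direction in which the link of a vertex is read.\<close>

definition flag :: "nat \<Rightarrow> nat \<times> nat \<Rightarrow> nat \<times> nat" where
  "flag v p = (if odd v then (snd p, fst p) else p)"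

text \<open>If the flags record the parity of the vertices, orienting the link of every even vertex
  along the cycle and of every odd vertex against it is coherent on each triangle.\<close>
theorem orientable_if_parity:
  assumes n: "even n" and par: "\<And>a b sa sb. (a, b, sa, sb) \<in> set its \<Longrightarrow> sa = odd a \<and> sb = odd b"
  shows "orientable K"
proof -
  \<comment> \<open>\<open>(u, v, w) \<in> Pos\<close> means that this order is positive as judged
    at the corner \<open>u\<close>, the link of an odd \<open>u\<close> being read
    backwards.\<close>
  define Pos where "Pos = {(u, v, w). u < n \<and> (\<exists>x y. flag u (x, y) \<in> cyc cs \<and>
    v = (u + x) mod n \<and> w = (u + y) mod n)}"
  have PosI: "(u, v, w) \<in> Pos"
    if "u < n" "flag u (x, y) \<in> cyc cs" "v = (u + x) mod n" "w = (u + y) mod n" for u v w x y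
    using that unfolding Pos_def by blast
  define rot where "rot p = (case p of (u, v, w) \<Rightarrow> (v, w, u))" for p :: "nat \<times> nat \<times> nat"
  have odd_mod: "odd (z mod n) = odd z" for z using n by (metis dvd_mod_iff)
  \<comment> \<open>Successors and predecessors on a cycle are unique, so a positive directed edge
    determines the triangle on it. This is what keeps distinct triangles from sharing a directed
    edge.\<close>
  have uniq: "w = w'" if "(u, v, w) \<in> Pos" "(u, v, w') \<in> Pos" for u v w w'
  proof -
    from that obtain x y x' y' where h: "flag u (x, y) \<in> cyc cs" "flag u (x', y') \<in> cyc cs"
      "(u + x) mod n = (u + x') mod n" "w = (u + y) mod n" "w' = (u + y') mod n"
      unfolding Pos_def by blast
    have "x < n" "x' < n" using h(1,2) cyc_range by (auto simp: flag_def split: if_splits)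
    then have "x = x'" using h(3) add_mod_inj by blast
    then have "y = y'" using h(1,2) cyc_out cyc_in by (auto simp: flag_def split: if_splits)
    then show ?thesis using h by simp
  qed
  have ex: "\<exists>p. p \<in> Pos \<and> rot p \<in> Pos \<and> rot (rot p) \<in> Pos \<and> (case p of (x, y, z) \<Rightarrow> {x, y, z} = t)"
    if "t \<in> K" for t
  proof -
    obtain a b sa sb i where it: "(a, b, sa, sb) \<in> set its" and i: "i < n"
      "t = {i, (i + a) mod n, (i + b) mod n}" using \<open>t \<in> K\<close> by (rule K_cases)
    have s: "sa = odd a" "sb = odd b" using par[OF it] by auto
    have r: "a < n" "b < n" using item_range[OF it] by auto
    let ?u = "i" and ?v = "(i + a) mod n" and ?w = "(i + b) mod n"
    have arcs: "(a, b) \<in> cyc cs" "flag a (dif n a b, n - a) \<in> cyc cs"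
      "flag b (n - b, dif n b a) \<in> cyc cs"
      using item_subset[OF it] by (auto simp: flag_def s split: if_splits)
    have vw: "?v < n" "?w < n" using i by auto
    have e: "(?v + dif n a b) mod n = ?w" "(?v + (n - a)) mod n = ?u"
      "(?w + dif n b a) mod n = ?v" "(?w + (n - b)) mod n = ?u"
      using r i(1) by (simp_all only: less_imp_le add_dif_mod' add_sub_mod)
    \<comment> \<open>As \<open>n\<close> is even, parity survives reduction modulo
      \<open>n\<close>. For odd \<open>i\<close> the judgements at all three corners therefore
      reverse together, and the reversed order of the triangle is the positive one.\<close>
    have fl: "flag ((i + z) mod n) (x, y) = (if even i then flag z (x, y) else flag z (y, x))" for x y z
      by (simp add: flag_def odd_mod)
    show ?thesis
    proof (cases "even i")
      case True
      have "(?u, ?v, ?w) \<in> Pos" using arcs(1) i(1) True by (intro PosI[of _ a b]) (simp_all add: flag_def)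
      moreover have "(?v, ?w, ?u) \<in> Pos"
        using arcs(2) vw True e by (intro PosI[of _ "dif n a b" "n - a"]) (simp_all add: fl)
      moreover have "(?w, ?u, ?v) \<in> Pos"
        using arcs(3) vw True e by (intro PosI[of _ "n - b" "dif n b a"]) (simp_all add: fl)
      ultimately show ?thesis using i(2) by (intro exI[of _ "(?u, ?v, ?w)"]) (simp add: rot_def insert_commute)
    next
      case False
      have "(?u, ?w, ?v) \<in> Pos" using arcs(1) i(1) False by (intro PosI[of _ b a]) (simp_all add: flag_def)
      moreover have "(?v, ?u, ?w) \<in> Pos"
        using arcs(2) vw False e by (intro PosI[of _ "n - a" "dif n a b"]) (simp_all add: fl)
      moreover have "(?w, ?v, ?u) \<in> Pos"
        using arcs(3) vw False e by (intro PosI[of _ "dif n b a" "n - b"]) (simp_all add: fl)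
      ultimately show ?thesis using i(2) by (intro exI[of _ "(?u, ?w, ?v)"]) (simp add: rot_def insert_commute)
    qed
  qed
  define \<sigma> where "\<sigma> t = (SOME p. p \<in> Pos \<and> rot p \<in> Pos \<and> rot (rot p) \<in> Pos \<and>
    (case p of (x, y, z) \<Rightarrow> {x, y, z} = t))" for t
  have sig: "\<sigma> t \<in> Pos \<and> rot (\<sigma> t) \<in> Pos \<and> rot (rot (\<sigma> t)) \<in> Pos \<and>
    (case \<sigma> t of (x, y, z) \<Rightarrow> {x, y, z} = t)" if "t \<in> K" for t
    unfolding \<sigma>_def using ex[OF that] by (rule someI_ex)
  have edge: "\<exists>w. (u, v, w) \<in> Pos \<and> {u, v, w} = t" if "t \<in> K" "(u, v) \<in> dir_edges (\<sigma> t)" for t u v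
  proof -
    obtain x y z where s: "\<sigma> t = (x, y, z)" by (cases "\<sigma> t")
    then have p: "(x, y, z) \<in> Pos" "(y, z, x) \<in> Pos" "(z, x, y) \<in> Pos" "{x, y, z} = t"
      using sig[OF that(1)] by (simp_all add: rot_def)
    have "(u, v) = (x, y) \<or> (u, v) = (y, z) \<or> (u, v) = (z, x)"
      using that(2) by (simp add: s dir_edges_def)
    moreover have "{x, y, z} = t" "{y, z, x} = t" "{z, x, y} = t" using p(4) by blast+
    ultimately show ?thesis using p(1-3) by (elim disjE) (metis Pair_inject)+
  qed
  have same: "t = t'" if "t \<in> K" "t' \<in> K" "(u, v) \<in> dir_edges (\<sigma> t)" "(u, v) \<in> dir_edges (\<sigma> t')" for t t' u v
  proof -
    note e = edge[OF that(1,3)] edge[OF that(2,4)]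
    from e(1) obtain w where w: "(u, v, w) \<in> Pos" "{u, v, w} = t" by (elim exE conjE)
    from e(2) obtain w' where "(u, v, w') \<in> Pos" "{u, v, w'} = t'" by (elim exE conjE)
    with w show ?thesis using uniq[of u v w w'] by simp
  qed
  have "\<forall>t\<in>K. \<forall>t'\<in>K. t \<noteq> t' \<longrightarrow> dir_edges (\<sigma> t) \<inter> dir_edges (\<sigma> t') = {}"
  proof (intro ballI impI equals0I)
    fix t t' e assume h: "t \<in> K" "t' \<in> K" "t \<noteq> t'" "e \<in> dir_edges (\<sigma> t) \<inter> dir_edges (\<sigma> t')"
    obtain u v where "e = (u, v)" by (cases e)
    with h(4) have "(u, v) \<in> dir_edges (\<sigma> t)" "(u, v) \<in> dir_edges (\<sigma> t')" by simp_all
    from same[OF h(1,2) this] h(3) show False by contradiction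
  qed
  moreover have "\<forall>t\<in>K. case \<sigma> t of (x, y, z) \<Rightarrow> {x, y, z} = t"
  proof
    fix t assume "t \<in> K"
    from sig[OF this] show "case \<sigma> t of (x, y, z) \<Rightarrow> {x, y, z} = t" by (elim conjE)
  qed
  ultimately show ?thesis unfolding orientable_def by (intro exI[of _ \<sigma>] conjI)
qed

text \<open>An orientation makes every vertex positive or negative with respect to the cyclic order of
  its link; a set flag forces the sign to change along the corresponding edge.\<close>
theorem not_orientable_if_flags:
  assumes it1: "(1, b0, True, sb) \<in> set its" and it2: "(a, b, sa, True) \<in> set its" and b: "even b"
  shows "\<not> orientable K"
proof
  assume "orientable K"
  then obtain \<sigma> where sig': "\<forall>t\<in>K. case \<sigma> t of (x, y, z) \<Rightarrow> {x, y, z} = t"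
    and disj': "\<forall>t\<in>K. \<forall>t'\<in>K. t \<noteq> t' \<longrightarrow> dir_edges (\<sigma> t) \<inter> dir_edges (\<sigma> t') = {}"
    unfolding orientable_def by (elim exE conjE)
  note sig = bspec[OF sig'] and disj = bspec[OF bspec[OF disj'], THEN mp]
  \<comment> \<open>On a single triangle an orientation picks one of the two cyclic orders; these
    three facts express that for directed edges.\<close>
  have anti: "(u, v) \<in> dir_edges (\<sigma> t) \<longleftrightarrow> (v, u) \<notin> dir_edges (\<sigma> t)"
    and trans: "(u, v) \<in> dir_edges (\<sigma> t) \<longleftrightarrow> (w, u) \<in> dir_edges (\<sigma> t)"
    and trans2: "(u, v) \<in> dir_edges (\<sigma> t) \<longleftrightarrow> (v, w) \<in> dir_edges (\<sigma> t)"
    if "t \<in> K" "t = {u, v, w}" for t u v w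
  proof -
    obtain x y z where s: "\<sigma> t = (x, y, z)" by (cases "\<sigma> t")
    then have xyz: "{x, y, z} = {u, v, w}" using sig[OF that(1)] that(2) by simp
    have "card t = 3" using tri_cover[OF that(1)] tri_card by blast
    then have c1: "card {u, v, w} = 3" by (subst that(2)[symmetric])
    have p: "(x, y, z) \<in> {(u, v, w), (v, w, u), (w, u, v), (v, u, w), (u, w, v), (w, v, u)}"
      using xyz c1 by (rule triple_cases)
    show "(u, v) \<in> dir_edges (\<sigma> t) \<longleftrightarrow> (v, u) \<notin> dir_edges (\<sigma> t)"
      "(u, v) \<in> dir_edges (\<sigma> t) \<longleftrightarrow> (w, u) \<in> dir_edges (\<sigma> t)"
      "(u, v) \<in> dir_edges (\<sigma> t) \<longleftrightarrow> (v, w) \<in> dir_edges (\<sigma> t)"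
      unfolding s using dir_edges_triple[OF p] card_3_distinct[OF c1] by blast+
  qed
  define pos where "pos v x y = ((v, (v + x) mod n) \<in> dir_edges (\<sigma> {v, (v + x) mod n, (v + y) mod n}))" for v x y
  define eps where "eps v = pos v (c 0) (c 1)" for v
  \<comment> \<open>Neighbouring triangles in the star of \<open>v\<close> induce opposite
    directions on their common edge, so the sign is carried from one to the next and is constant
    around the link.\<close>
  have step: "pos v (c i) (c (Suc i)) = pos v (c (Suc i)) (c (Suc (Suc i)))" if v: "v < n" for v i
  proof -
    let ?w = "(v + c (Suc i)) mod n"
    have t: "tri v i \<in> K" "tri v (Suc i) \<in> K" "tri v i \<noteq> tri v (Suc i)"
      using tri_in[OF v] tri_inj[OF v] mod_Suc_neq(1) by auto
    let ?a = "(v + c i) mod n" and ?b = "(v + c (Suc (Suc i))) mod n"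
    have "tri v i = {v, ?a, ?w}" "tri v i = {v, ?w, ?a}" "tri v (Suc i) = {v, ?w, ?b}"
      unfolding tri_def by auto
    note e = this
    have "(v, ?a) \<in> dir_edges (\<sigma> (tri v i)) \<longleftrightarrow> (?w, v) \<in> dir_edges (\<sigma> (tri v i))"
      by (rule trans[OF t(1) e(1)])
    also have "\<dots> \<longleftrightarrow> (v, ?w) \<in> dir_edges (\<sigma> (tri v (Suc i)))"
      using anti[OF t(2) e(3)] anti[OF t(1) e(2)] disj[OF t] by blast
    finally show ?thesis unfolding pos_def tri_def .
  qed
  have const: "pos v (c i) (c (Suc i)) = eps v" if "v < n" for v i
    by (induction i) (use step[OF that] in \<open>simp_all add: eps_def\<close>)
  have arc: "pos v x y = eps v" if "v < n" "(x, y) \<in> cyc cs" for v x y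
    using that const unfolding cyc_c by auto
  \<comment> \<open>A set flag means that the cycle at \<open>v + a\<close> runs against the
    triangle, while the cycle at \<open>v\<close> runs along it; the two signs are opposite.\<close>
  have flip_a: "eps ((v + a) mod n) = (\<not> eps v)" if it: "(a, b, True, sb) \<in> set its" and v: "v < n" for a b sb v
  proof -
    let ?v = "(v + a) mod n" and ?w = "(v + b) mod n"
    have r: "a < n" "b < n" using item_range[OF it] by auto
    have t: "{v, ?v, ?w} \<in> K" using K_intro[OF it v] .
    have "eps v = ((v, ?v) \<in> dir_edges (\<sigma> {v, ?v, ?w}))"
      using arc[OF v, of a b] item_subset[OF it] by (simp add: pos_def)
    moreover have "(?v + (n - a)) mod n = v" "(?v + dif n a b) mod n = ?w" "{?v, v, ?w} = {v, ?v, ?w}"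
      using r v by (simp_all only: less_imp_le add_dif_mod' add_sub_mod insert_commute)
    then have "pos ?v (n - a) (dif n a b) = ((?v, v) \<in> dir_edges (\<sigma> {v, ?v, ?w}))"
      unfolding pos_def by (simp only:)
    moreover have "pos ?v (n - a) (dif n a b) = eps ?v"
      using item_subset[OF it] v by (intro arc) simp_all
    ultimately show ?thesis using anti[OF t refl] by blast
  qed
  have flip_b: "eps ((v + b) mod n) = (\<not> eps v)" if it: "(a, b, sa, True) \<in> set its" and v: "v < n" for a b sa v
  proof -
    let ?v = "(v + a) mod n" and ?w = "(v + b) mod n"
    have r: "a < n" "b < n" using item_range[OF it] by auto
    have t: "{v, ?v, ?w} \<in> K" using K_intro[OF it v] .
    have "eps v = ((v, ?v) \<in> dir_edges (\<sigma> {v, ?v, ?w}))"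
      using arc[OF v, of a b] item_subset[OF it] by (simp add: pos_def)
    moreover have e: "{?w, ?v, v} = {v, ?v, ?w}" "{v, ?v, ?w} = {?v, ?w, v}" by auto
    moreover have "(?w + (n - b)) mod n = v" "(?w + dif n b a) mod n = ?v"
      using r v by (simp_all only: less_imp_le add_dif_mod' add_sub_mod)
    then have "pos ?w (dif n b a) (n - b) = ((?w, ?v) \<in> dir_edges (\<sigma> {v, ?v, ?w}))"
      unfolding pos_def by (simp only: e(1))
    moreover have "pos ?w (dif n b a) (n - b) = eps ?w"
      using item_subset[OF it] v by (intro arc) simp_all
    ultimately show ?thesis using trans2[OF t refl] anti[OF t e(2)] by blast
  qed
  \<comment> \<open>The first item has \<open>a = 1\<close> with its flag set, so every unit step
    flips the sign.\<close>
  have alt: "eps v = (if even v then eps 0 else \<not> eps 0)" if "v < n" for v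
    using that
  proof (induction v)
    case (Suc v)
    then show ?case using flip_a[OF it1, of v] by simp
  qed simp
  have "b < n" using item_range[OF it2] by simp
  then show False using flip_b[OF it2, of 0] alt[of b] b n_pos by simp
qed

end

section \<open>The infinite families\<close>

text \<open>In closed form \<open>qs g = 3 ^ (g + 1) - 1\<close>, the sum of the sides \<open>x\<^sub>0 x\<^sub>0 \<dots> x\<^sub>g x\<^sub>g\<close>.\<close>
fun qs :: "nat \<Rightarrow> nat" where
  "qs 0 = 2"
| "qs (Suc g) = 3 * qs g + 2"

text \<open>The fan from corner 0. The next side \<open>3 ^ (g + 1)\<close> equals
  \<open>qs g + 1\<close> and occurs twice, so the corners after \<open>qs g\<close> are
  \<open>2 * qs g + 1\<close> and \<open>3 * qs g + 2\<close>.\<close>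

fun spine :: "nat \<Rightarrow> (nat \<times> nat \<times> bool \<times> bool) list" where
  "spine 0 = [(1, 2, True, False)]"
| "spine (Suc g) = spine g @
     [(qs g, 2 * qs g + 1, False, True), (2 * qs g + 1, 3 * qs g + 2, True, False)]"

text \<open>The part of the link of 0 contributed by \<open>spine g\<close>, running from
  \<open>-qs g\<close> to \<open>qs g\<close>; each new pair of triangles lengthens it at both
  ends.\<close>

fun path :: "nat \<Rightarrow> nat \<Rightarrow> nat list" where
  "path n 0 = [n - 2, n - 1, 1, 2]"
| "path n (Suc g) =
     [n - (3 * qs g + 2), n - (qs g + 1), n - (2 * qs g + 1), qs g + 1] @
     path n g @ [2 * qs g + 1, 3 * qs g + 2]"

lemma qs_ge: "2 \<le> qs g" by (induction g) auto

lemma qs_even: "even (qs g)" by (induction g) auto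

lemma path_ne [simp]: "path n g \<noteq> []" by (cases g) auto

lemma path_hd [simp]: "hd (path n g) = n - qs g" by (cases g) auto

lemma path_last [simp]: "last (path n g) = qs g" by (cases g) auto

lemma path_length: "length (path n g) = 6 * g + 4" by (induction g) auto

lemma path_one: "1 \<in> set (path n g)" by (induction g) auto

lemma path_range: "2 * qs g < n \<Longrightarrow> set (path n g) \<subseteq> {1..qs g} \<union> {n - qs g..<n}"
proof (induction g)
  case (Suc g)
  then have "set (path n g) \<subseteq> {1..qs g} \<union> {n - qs g..<n}" by simp
  moreover have "{1..qs g} \<subseteq> {1..qs (Suc g)}" "{n - qs g..<n} \<subseteq> {n - qs (Suc g)..<n}" by auto
  moreover have "set [n - (3 * qs g + 2), n - (qs g + 1), n - (2 * qs g + 1)] \<subseteq> {n - qs (Suc g)..<n}"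
    "set [qs g + 1, 2 * qs g + 1, 3 * qs g + 2] \<subseteq> {1..qs (Suc g)}"
    using Suc.prems by auto
  ultimately show ?case unfolding path.simps set_append by (simp only: set_simps) blast
qed auto

lemma path_distinct: "2 * qs g < n \<Longrightarrow> distinct (path n g)"
proof (induction g)
  case (Suc g)
  then have d: "distinct (path n g)" and r: "set (path n g) \<subseteq> {1..qs g} \<union> {n - qs g..<n}"
    using path_range[of g n] by simp_all
  have new: "x \<notin> set (path n g)" if "qs g < x" "x < n - qs g" for x
    using r that by auto
  have "x \<notin> set (path n g)"
    if "x \<in> set [n - (3 * qs g + 2), n - (qs g + 1), n - (2 * qs g + 1), qs g + 1, 2 * qs g + 1, 3 * qs g + 2]" for x
    using that Suc.prems qs_ge[of g] by (intro new) auto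
  moreover have "distinct [n - (3 * qs g + 2), n - (qs g + 1), n - (2 * qs g + 1), qs g + 1, 2 * qs g + 1, 3 * qs g + 2]"
    using Suc.prems qs_ge[of g] by auto
  ultimately show ?case using d by simp
qed auto

lemma item_arcs_le:
  assumes "a < b" "b < n"
  shows "item_arcs n (a, b, sa, sb) = {(a, b), if sa then (n - a, b - a) else (b - a, n - a),
    if sb then (n - (b - a), n - b) else (n - b, n - (b - a))}"
proof -
  have "dif n b a = n - (b - a)" using dif_gt[of a b n] assms by simp
  moreover have "dif n a b = b - a" using dif_le[of a b n] assms by simp
  ultimately show ?thesis by simp
qed

text \<open>Of the six arcs of the two new triangles, four lead up to the head of the old path and
  two lead on from its last vertex.\<close>

lemma spine_arcs: "2 * qs g < n \<Longrightarrow> (\<Union>it\<in>set (spine g). item_arcs n it) = arcs (path n g)"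
proof (induction g)
  case 0
  then show ?case by (simp add: item_arcs_le del: item_arcs.simps) auto
next
  case (Suc g)
  have IH: "(\<Union>it\<in>set (spine g). item_arcs n it) = arcs (path n g)" using Suc by simp
  have Q: "6 * qs g + 4 < n" using Suc.prems by simp
  have "item_arcs n (qs g, 2 * qs g + 1, False, True) =
    {(qs g, 2 * qs g + 1), (qs g + 1, n - qs g), (n - (qs g + 1), n - (2 * qs g + 1))}"
    using Q by (subst item_arcs_le) auto
  moreover have "item_arcs n (2 * qs g + 1, 3 * qs g + 2, True, False) =
    {(2 * qs g + 1, 3 * qs g + 2), (n - (2 * qs g + 1), qs g + 1), (n - (3 * qs g + 2), n - (qs g + 1))}"
    using Q by (subst item_arcs_le) auto
  moreover have "(\<Union>it\<in>set (spine (Suc g)). item_arcs n it) = arcs (path n g)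
     \<union> item_arcs n (qs g, 2 * qs g + 1, False, True) \<union> item_arcs n (2 * qs g + 1, 3 * qs g + 2, True, False)"
    using IH by auto
  moreover have "arcs (path n (Suc g)) = arcs (path n g) \<union>
    {(n - (3 * qs g + 2), n - (qs g + 1)), (n - (qs g + 1), n - (2 * qs g + 1)),
     (n - (2 * qs g + 1), qs g + 1), (qs g + 1, n - qs g), (qs g, 2 * qs g + 1), (2 * qs g + 1, 3 * qs g + 2)}"
    by (simp only: path.simps arcs_append path_ne append_is_Nil_conv list.distinct arcs.simps simp_thms
      path_hd path_last hd_append2 not_False_eq_True last.simps list.sel if_True if_False) auto
  ultimately show ?case by (simp only:) blast
qed

lemma spine_parity: "(a, b, sa, sb) \<in> set (spine g) \<Longrightarrow> sa = odd a \<and> sb = odd b"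
  using qs_even by (induction g) auto

lemma spine_one: "(1, 2, True, False) \<in> set (spine g)" by (induction g) auto

text \<open>The remaining triangles only have to close the path: their arcs go from
  \<open>qs g\<close> through \<open>ts\<close> to \<open>n - qs g\<close>, and the values strictly
  between these two do not occur on the path.\<close>

lemma signed_base_path:
  assumes n: "2 * qs g < n" and tail: "ts \<noteq> []" "distinct ts" "set ts \<subseteq> {qs g<..<n - qs g}"
    and arcs: "(\<Union>it\<in>set its. item_arcs n it) = insert (qs g, hd ts) (insert (last ts, n - qs g) (arcs ts))"
  shows "signed_base n (spine g @ its) (path n g @ ts)"
proof
  show "3 \<le> length (path n g @ ts)" by (simp add: path_length)
  have "set (path n g) \<inter> set ts = {}" using path_range[OF n] tail(3) by fastforce
  then show "distinct (path n g @ ts)" using path_distinct[OF n] tail(2) by simp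
  show "set (path n g @ ts) \<subseteq> {1..<n}" using path_range[OF n] tail(3) n qs_ge[of g] by fastforce
  show "(\<Union>it\<in>set (spine g @ its). item_arcs n it) = cyc (path n g @ ts)"
    using tail(1) arcs spine_arcs[OF n] by (subst cyc_arcs) (auto simp: arcs_append)
qed

text \<open>Different members have different numbers of vertices, so cardinality alone excludes
  isomorphisms.\<close>

lemma infinite_familyI:
  assumes "infinite Y" "inj_on N Y" "\<And>y. y \<in> Y \<Longrightarrow> cyclic_triangulation (N y) (F y)"
    "\<And>y. y \<in> Y \<Longrightarrow> equivelar q (F y)" "\<And>y. y \<in> Y \<Longrightarrow> P (F y)"
  shows "\<exists>S. infinite S \<and> (\<forall>K\<in>S. (\<exists>n. cyclic_triangulation n K) \<and> equivelar q K \<and> P K) \<and>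
    (\<forall>K\<in>S. \<forall>L\<in>S. K \<noteq> L \<longrightarrow> \<not> iso K L)"
proof (intro exI conjI)
  have verts: "cverts (F y) = {0..<N y}" if "y \<in> Y" for y
    using assms(3)[OF that] unfolding cyclic_triangulation_def by simp
  have "y = z" if "y \<in> Y" "z \<in> Y" "iso (F y) (F z)" for y z
  proof -
    from that(3) have "card (cverts (F y)) = card (cverts (F z))"
      unfolding iso_def by (elim exE conjE) (rule bij_betw_same_card)
    then show ?thesis using verts that(1,2) assms(2) by (simp add: inj_on_def)
  qed
  then show "\<forall>K\<in>F ` Y. \<forall>L\<in>F ` Y. K \<noteq> L \<longrightarrow> \<not> iso K L"
    unfolding ball_simps by (intro ballI impI notI) metis
  have "inj_on F Y" using verts assms(2) unfolding inj_on_def by (metis card_atLeastLessThan diff_zero)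
  then show "infinite (F ` Y)" using assms(1) finite_imageD by blast
  show "\<forall>K\<in>F ` Y. (\<exists>n. cyclic_triangulation n K) \<and> equivelar q K \<and> P K"
  proof
    fix K assume "K \<in> F ` Y"
    then obtain y where y: "y \<in> Y" "K = F y" by (rule imageE)
    show "(\<exists>n. cyclic_triangulation n K) \<and> equivelar q K \<and> P K"
      unfolding y(2) using assms(3-5)[OF y(1)] by (intro conjI exI)
  qed
qed

lemma infinite_parity: "infinite {y::nat. a < y \<and> odd y}" "infinite {y::nat. a < y \<and> even y}"
proof -
  have inf: "infinite (range (\<lambda>m::nat. 2 * m + c))" for c
    using finite_imageD[of "\<lambda>m::nat. 2 * m + c" UNIV] by (auto simp: inj_def)
  have "range (\<lambda>m. 2 * m + (2 * a + 1)) \<subseteq> {y. a < y \<and> odd y}" by auto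
  from infinite_super[OF this inf] show "infinite {y::nat. a < y \<and> odd y}" .
  have "range (\<lambda>m. 2 * m + (2 * a + 2)) \<subseteq> {y. a < y \<and> even y}" by auto
  from infinite_super[OF this inf] show "infinite {y::nat. a < y \<and> even y}" .
qed

text \<open>Only the base vertex \<open>qs g + y\<close> has a parity depending on \<open>y\<close>, and its flag is set: for odd \<open>y\<close>
  all flags record parities, for even \<open>y\<close> this one contradicts the flag of the triangle
  \<open>{0, 1, 2}\<close>.\<close>
lemma families_from_tail:
  fixes ts :: "nat \<Rightarrow> nat list" and m :: nat
  assumes m: "0 < m"
    and base: "\<And>y. qs g < y \<Longrightarrow> signed_base (m * (qs g + 2 * y))
      (spine g @ (qs g, qs g + y, False, True) # its y) (path (m * (qs g + 2 * y)) g @ ts y)"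
    and ts_len: "\<And>y. length (ts y) = l"
    and par: "\<And>y a b sa sb. odd y \<Longrightarrow> (a, b, sa, sb) \<in> set (its y) \<Longrightarrow> sa = odd a \<and> sb = odd b"
  shows "(\<exists>S. infinite S \<and>
      (\<forall>K\<in>S. (\<exists>n. cyclic_triangulation n K) \<and> equivelar (6 * g + 4 + l) K \<and> orientable K) \<and>
      (\<forall>K\<in>S. \<forall>L\<in>S. K \<noteq> L \<longrightarrow> \<not> iso K L)) \<and>
    (\<exists>S. infinite S \<and>
      (\<forall>K\<in>S. (\<exists>n. cyclic_triangulation n K) \<and> equivelar (6 * g + 4 + l) K \<and> \<not> orientable K) \<and>
      (\<forall>K\<in>S. \<forall>L\<in>S. K \<noteq> L \<longrightarrow> \<not> iso K L))"
proof -
  define N where "N y = m * (qs g + 2 * y)" for y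
  define Its where "Its y = spine g @ (qs g, qs g + y, False, True) # its y" for y
  define F where "F y = generated (N y) (map base_tri (Its y))" for y
  have sb: "signed_base (N y) (Its y) (path (N y) g @ ts y)" if "qs g < y" for y
    using base[OF that] unfolding N_def Its_def .
  have cyc: "cyclic_triangulation (N y) (F y)" "equivelar (6 * g + 4 + l) (F y)" if "qs g < y" for y
  proof -
    interpret signed_base "N y" "Its y" "path (N y) g @ ts y" by (rule sb[OF that])
    have "1 \<in> set (path (N y) g @ ts y)" using path_one by simp
    from cyclic_equivelar[OF this] show "cyclic_triangulation (N y) (F y)"
      "equivelar (6 * g + 4 + l) (F y)" by (simp_all add: F_def path_length ts_len)
  qed
  have ori: "orientable (F y)" if "qs g < y" "odd y" for y
  proof -
    interpret signed_base "N y" "Its y" "path (N y) g @ ts y" by (rule sb[OF that(1)])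
    have "even (N y)" by (simp add: N_def qs_even)
    moreover have "sa = odd a \<and> sb = odd b" if "(a, b, sa, sb) \<in> set (Its y)" for a b sa sb
      using that spine_parity[of a b sa sb g] par[OF \<open>odd y\<close>, of a b sa sb] \<open>odd y\<close> qs_even[of g]
      unfolding Its_def by auto
    ultimately show ?thesis unfolding F_def by (rule orientable_if_parity)
  qed
  have non: "\<not> orientable (F y)" if "qs g < y" "even y" for y
  proof -
    interpret signed_base "N y" "Its y" "path (N y) g @ ts y" by (rule sb[OF that(1)])
    have "(1, 2, True, False) \<in> set (Its y)" "(qs g, qs g + y, False, True) \<in> set (Its y)"
      using spine_one by (simp_all add: Its_def)
    then show ?thesis unfolding F_def by (rule not_orientable_if_flags) (simp add: that qs_even)
  qed
  have inj: "inj_on N Y" for Y using m by (simp add: N_def inj_on_def)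
  show ?thesis
    by (rule conjI[OF infinite_familyI[OF infinite_parity(1)[of "qs g"] inj, of F _ orientable]
      infinite_familyI[OF infinite_parity(2)[of "qs g"] inj, of F _ "\<lambda>K. \<not> orientable K"]])
      (auto intro: cyc ori dest: non)
qed

lemma families:
  assumes q: "q \<in> {6 * g + 6, 6 * g + 9, 6 * g + 10, 6 * g + 13}"
  shows "(\<exists>S. infinite S \<and>
      (\<forall>K\<in>S. (\<exists>n. cyclic_triangulation n K) \<and> equivelar q K \<and> orientable K) \<and>
      (\<forall>K\<in>S. \<forall>L\<in>S. K \<noteq> L \<longrightarrow> \<not> iso K L)) \<and>
    (\<exists>S. infinite S \<and>
      (\<forall>K\<in>S. (\<exists>n. cyclic_triangulation n K) \<and> equivelar q K \<and> \<not> orientable K) \<and>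
      (\<forall>K\<in>S. \<forall>L\<in>S. K \<noteq> L \<longrightarrow> \<not> iso K L))"
proof -
  let ?Q = "qs g"
  let ?R = "\<lambda>y. ?Q + 2 * y"
  note Q = qs_ge[of g] qs_even[of g]
  have it1: "item_arcs n (?Q, ?Q + y, False, True) =
      {(?Q, ?Q + y), (y, n - ?Q), (n - y, n - (?Q + y))}" if "?Q < y" "?R y \<le> n" for n y
    using that Q by (subst item_arcs_le) auto
  have it2: "item_arcs n (?Q + y, ?R y, True, False) =
      {(?Q + y, ?R y), (n - (?Q + y), y), (n - ?R y, n - y)}" if "?Q < y" "2 * ?R y \<le> n" for n y
    using that Q by (subst item_arcs_le) auto
  note set_simp = list.set UN_insert UN_empty Un_empty_right arcs.simps list.sel last.simps
    list.distinct if_False refl if_True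
  consider "q = 6 * g + 4 + 2" | "q = 6 * g + 4 + 5" | "q = 6 * g + 4 + 6" | "q = 6 * g + 4 + 9"
    using q by auto
  then show ?thesis
  proof cases
    \<comment> \<open>The corner \<open>?Q + 2 * y\<close> is 0 modulo \<open>n\<close>: the polygon
      closes, and one triangle carries both sides \<open>y\<close>.\<close>
    case 1
    show ?thesis unfolding 1
    proof (rule families_from_tail[where m = 1 and its = "\<lambda>y. []" and ts = "\<lambda>y. [?Q + y, y]"])
      fix y assume y: "?Q < y"
      show "signed_base (1 * ?R y) (spine g @ [(?Q, ?Q + y, False, True)]) (path (1 * ?R y) g @ [?Q + y, y])"
        using y Q by (intro signed_base_path) (auto simp: it1 simp del: item_arcs.simps)
    qed auto
  next
    \<comment> \<open>Here \<open>?R y\<close> is \<open>n/2\<close>. The half turn maps the edge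
      \<open>{0, ?R y}\<close> to itself, so its two triangles lie in one orbit.\<close>
    case 2
    show ?thesis unfolding 2
    proof (rule families_from_tail[where m = 2 and its = "\<lambda>y. [(?Q + y, ?R y, True, False)]"
          and ts = "\<lambda>y. [?Q + y, ?R y, ?Q + ?R y + y, ?R y + y, y]"])
      fix y assume y: "?Q < y"
      show "signed_base (2 * ?R y) (spine g @ [(?Q, ?Q + y, False, True), (?Q + y, ?R y, True, False)])
        (path (2 * ?R y) g @ [?Q + y, ?R y, ?Q + ?R y + y, ?R y + y, y])"
        (is "signed_base ?n _ (_ @ ?ts)")
      proof (rule signed_base_path)
        show "2 * ?Q < ?n" "?ts \<noteq> []" using y by simp_all
        show "distinct ?ts" using y Q(1) by simp
        show "set ?ts \<subseteq> {?Q<..<?n - ?Q}" using y Q(1) by simp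
        have "item_arcs ?n (?Q, ?Q + y, False, True) =
            {(?Q, ?Q + y), (y, ?n - ?Q), (?Q + ?R y + y, ?R y + y)}"
          using y by (subst it1) auto
        moreover have "item_arcs ?n (?Q + y, ?R y, True, False) =
            {(?Q + y, ?R y), (?R y + y, y), (?R y, ?Q + ?R y + y)}"
          using y by (subst it2) auto
        ultimately show "(\<Union>it\<in>set [(?Q, ?Q + y, False, True), (?Q + y, ?R y, True, False)]. item_arcs ?n it) =
            insert (?Q, hd ?ts) (insert (last ?ts, ?n - ?Q) (arcs ?ts))"
          by (simp only: set_simp) blast
      qed
    qed (use Q in auto)
  next
    \<comment> \<open>Here \<open>?R y\<close> is \<open>n/3\<close>. The last side is glued to
      \<open>{0, n/3, 2n/3}\<close>, whose orbit is short and whose three arcs are one.\<close>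
    case 3
    show ?thesis unfolding 3
    proof (rule families_from_tail[where m = 3 and
          its = "\<lambda>y. [(?Q + y, ?R y, True, False), (?R y, 2 * ?R y, False, False)]"
          and ts = "\<lambda>y. [?Q + y, ?R y, 2 * ?R y, ?Q + 2 * ?R y + y, 2 * ?R y + y, y]"])
      fix y assume y: "?Q < y"
      have "item_arcs (3 * ?R y) (?R y, 2 * ?R y, False, False) = {(?R y, 2 * ?R y)}"
        using y Q by (subst item_arcs_le) auto
      note e = this
      show "signed_base (3 * ?R y) (spine g @ [(?Q, ?Q + y, False, True), (?Q + y, ?R y, True, False),
          (?R y, 2 * ?R y, False, False)])
        (path (3 * ?R y) g @ [?Q + y, ?R y, 2 * ?R y, ?Q + 2 * ?R y + y, 2 * ?R y + y, y])"
        (is "signed_base ?n _ (_ @ ?ts)")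
      proof (rule signed_base_path)
        show "2 * ?Q < ?n" "?ts \<noteq> []" using y by simp_all
        show "distinct ?ts" using y Q(1) by simp
        show "set ?ts \<subseteq> {?Q<..<?n - ?Q}" using y Q(1) by simp
        have "item_arcs ?n (?Q, ?Q + y, False, True) =
            {(?Q, ?Q + y), (y, ?n - ?Q), (?Q + 2 * ?R y + y, 2 * ?R y + y)}"
          using y by (subst it1) auto
        moreover have "item_arcs ?n (?Q + y, ?R y, True, False) =
            {(?Q + y, ?R y), (2 * ?R y + y, y), (2 * ?R y, ?Q + 2 * ?R y + y)}"
          using y by (subst it2) auto
        ultimately show "(\<Union>it\<in>set [(?Q, ?Q + y, False, True), (?Q + y, ?R y, True, False), (?R y, 2 * ?R y, False, False)]. item_arcs ?n it) =
            insert (?Q, hd ?ts) (insert (last ?ts, ?n - ?Q) (arcs ?ts))"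
          using e by (simp only: set_simp) blast
      qed
    qed (use Q in auto)
  next
    \<comment> \<open>Here \<open>?R y\<close> is \<open>n/6\<close>, and the extra corner
      \<open>3 * ?R y\<close> creates the sides \<open>n/3\<close> and \<open>n/2\<close>: the first
      is glued to the short orbit, the second to its own half-turn image. The short triangle is
      entered from \<open>4 * ?R y\<close> to \<open>2 * ?R y\<close> because the link passes it in
      that direction.\<close>
    case 4
    show ?thesis unfolding 4
    proof (rule families_from_tail[where m = 6 and
          its = "\<lambda>y. [(?Q + y, ?R y, True, False), (?R y, 3 * ?R y, False, False),
            (4 * ?R y, 2 * ?R y, False, False)]"
          and ts = "\<lambda>y. [?Q + y, ?R y, 3 * ?R y, 4 * ?R y, 2 * ?R y, 5 * ?R y,
            ?Q + 5 * ?R y + y, 5 * ?R y + y, y]"])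
      fix y assume y: "?Q < y"
      have "item_arcs (6 * ?R y) (?R y, 3 * ?R y, False, False) =
          {(?R y, 3 * ?R y), (2 * ?R y, 5 * ?R y), (3 * ?R y, 4 * ?R y)}"
        using y Q by (subst item_arcs_le) auto
      moreover have "item_arcs (6 * ?R y) (4 * ?R y, 2 * ?R y, False, False) = {(4 * ?R y, 2 * ?R y)}"
        using y Q by (auto simp: dif_le dif_gt)
      ultimately have e: "item_arcs (6 * ?R y) (?R y, 3 * ?R y, False, False) =
          {(?R y, 3 * ?R y), (2 * ?R y, 5 * ?R y), (3 * ?R y, 4 * ?R y)}"
          "item_arcs (6 * ?R y) (4 * ?R y, 2 * ?R y, False, False) = {(4 * ?R y, 2 * ?R y)}" .
      show "signed_base (6 * ?R y) (spine g @ [(?Q, ?Q + y, False, True),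
          (?Q + y, ?R y, True, False), (?R y, 3 * ?R y, False, False), (4 * ?R y, 2 * ?R y, False, False)])
        (path (6 * ?R y) g @ [?Q + y, ?R y, 3 * ?R y, 4 * ?R y, 2 * ?R y, 5 * ?R y,
          ?Q + 5 * ?R y + y, 5 * ?R y + y, y])"
        (is "signed_base ?n _ (_ @ ?ts)")
      proof (rule signed_base_path)
        show "2 * ?Q < ?n" "?ts \<noteq> []" using y by simp_all
        show "distinct ?ts" using y Q(1) by simp
        show "set ?ts \<subseteq> {?Q<..<?n - ?Q}" using y Q(1) by simp
        have "item_arcs ?n (?Q, ?Q + y, False, True) =
            {(?Q, ?Q + y), (y, ?n - ?Q), (?Q + 5 * ?R y + y, 5 * ?R y + y)}"
          using y by (subst it1) auto
        moreover have "item_arcs ?n (?Q + y, ?R y, True, False) =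
            {(?Q + y, ?R y), (5 * ?R y + y, y), (5 * ?R y, ?Q + 5 * ?R y + y)}"
          using y by (subst it2) auto
        ultimately show "(\<Union>it\<in>set [(?Q, ?Q + y, False, True), (?Q + y, ?R y, True, False), (?R y, 3 * ?R y, False, False), (4 * ?R y, 2 * ?R y, False, False)]. item_arcs ?n it) =
            insert (?Q, hd ?ts) (insert (last ?ts, ?n - ?Q) (arcs ?ts))"
          using e by (simp only: set_simp) blast
      qed
    qed (use Q in auto)
  qed
qed

section \<open>Counting edges and triangles, and adjacency of vertices\<close>

context cyclic_link
begin

text \<open>Incidences of triangles with vertices and with edges, each counted in two ways.\<close>

lemma double_count: "3 * card K = n * L" "2 * card (tri_edges K) = n * L"
proof -
  have "K \<subseteq> Pow {0..<n}" using verts by (auto simp: atLeast0LessThan)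
  then have fin: "finite K" by (rule finite_subset) simp
  have "(\<Sum>t\<in>K. card {v \<in> {0..<n}. v \<in> t}) = L * card {0..<n}"
    using fin card_star by (intro sum_multicount) auto
  moreover have "card {v \<in> {0..<n}. v \<in> t} = 3" if "t \<in> K" for t
  proof -
    have "{v \<in> {0..<n}. v \<in> t} = t" using verts[OF that] by auto
    then show ?thesis using tri_cover[OF that] tri_card by auto
  qed
  then have "(\<Sum>t\<in>K. card {v \<in> {0..<n}. v \<in> t}) = (\<Sum>t\<in>K. 3)" by (rule sum.cong[OF refl])
  ultimately show K: "3 * card K = n * L" by (simp add: mult.commute)
  have "tri_edges K \<subseteq> Pow {0..<n}" unfolding tri_edges_def using \<open>K \<subseteq> Pow {0..<n}\<close> by blast
  then have finE: "finite (tri_edges K)" by (rule finite_subset) simp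
  have "card {t \<in> K. e \<subseteq> t} = 2" if "e \<in> tri_edges K" for e
    using that by (rule two_triangles)
  then have "(\<Sum>t\<in>K. card {e \<in> tri_edges K. e \<subseteq> t}) = 2 * card (tri_edges K)"
    using fin finE by (intro sum_multicount) auto
  moreover have "card {e \<in> tri_edges K. e \<subseteq> t} = 3" if "t \<in> K" for t
  proof -
    have c: "card t = 3" using tri_cover[OF that] tri_card by auto
    then have "finite t" by (simp add: card_ge_0_finite)
    moreover have "{e \<in> tri_edges K. e \<subseteq> t} = {e. e \<subseteq> t \<and> card e = 2}"
      unfolding tri_edges_def using that by auto
    ultimately show ?thesis using n_subsets[of t 2] c by (simp add: choose_two)
  qed
  then have "(\<Sum>t\<in>K. card {e \<in> tri_edges K. e \<subseteq> t}) = (\<Sum>t\<in>K. 3)" by (rule sum.cong[OF refl])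
  ultimately show "2 * card (tri_edges K) = n * L" using K by (simp add: mult.commute)
qed

text \<open>The factor 6 clears the denominators of \<open>n - n L / 2 + n L / 3\<close>. For
  \<open>n = 12\<close> and \<open>L = 7\<close> the value is -2, which is genus 2 in the orientable
  case.\<close>

lemma euler_char_eq: "6 * euler_char K = int n * (6 - int L)"
  unfolding euler_char_def verts_eq using double_count by (simp add: algebra_simps flip: of_nat_mult)

lemma adjacent_iff:
  assumes "u < n" "v < n" "u \<noteq> v"
  shows "(\<exists>t\<in>K. u \<in> t \<and> v \<in> t) \<longleftrightarrow> dif n u v \<in> set cs"
proof
  assume "dif n u v \<in> set cs"
  then obtain i where "dif n u v = c i" using in_cs by blast
  then have "v \<in> tri u i" using add_dif_eq[OF assms(1,2)] by (simp add: tri_def)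
  then show "\<exists>t\<in>K. u \<in> t \<and> v \<in> t" using tri_in[OF assms(1)] by (auto simp: tri_def)
next
  assume "\<exists>t\<in>K. u \<in> t \<and> v \<in> t"
  then obtain i where "v \<in> tri u i" using tri_iff[OF assms(1)] by auto
  then obtain j where "v = (u + c j) mod n" using assms(3) unfolding tri_def by blast
  then have "(u + c j) mod n = (u + dif n u v) mod n" using add_dif_eq[OF assms(1,2)] by simp
  then have "dif n u v = c j" using add_mod_inj[of "c j" n "dif n u v" u] c_range dif_lt[OF n_pos] by simp
  then show "dif n u v \<in> set cs" using c_in by simp
qed

end

section \<open>The two triangulations with 12 vertices\<close>

definition T1 :: "nat set set" where "T1 = generated 12 [{0, 1, 2}, {0, 2, 6}, {0, 4, 8}]"
definition T2 :: "nat set set" where "T2 = generated 12 [{0, 1, 5}, {0, 1, 6}, {0, 4, 8}]"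

text \<open>The order of the two vertices in each item makes its arcs follow the given link. All
  flags here and in \<open>base_T2\<close> are parities, so orientability will come from the parity
  criterion.\<close>

lemma base_T1: "signed_base 12 [(1, 2, True, False), (2, 6, False, False), (8, 4, False, False)] [1, 2, 6, 8, 4, 10, 11]"
  by unfold_locales (auto simp: cyc_arcs dif_def)

lemma base_T2: "signed_base 12 [(1, 5, True, True), (6, 1, False, True), (4, 8, False, False)] [1, 5, 11, 4, 8, 7, 6]"
  by unfold_locales (auto simp: cyc_arcs dif_def)

interpretation T1: signed_base 12 "[(1, 2, True, False), (2, 6, False, False), (8, 4, False, False)]"
    "[1, 2, 6, 8, 4, 10, 11]"
  rewrites "generated 12 (map base_tri [(1, 2, True, False), (2, 6, False, False), (8, 4, False, False)]) = T1"
  by (rule base_T1) (simp add: T1_def insert_commute)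

interpretation T2: signed_base 12 "[(1, 5, True, True), (6, 1, False, True), (4, 8, False, False)]"
    "[1, 5, 11, 4, 8, 7, 6]"
  rewrites "generated 12 (map base_tri [(1, 5, True, True), (6, 1, False, True), (4, 8, False, False)]) = T2"
  by (rule base_T2) (simp add: T2_def insert_commute)

lemma T1_link: "cyclic_link 12 T1 [1, 2, 6, 8, 4, 10, 11]" by (rule T1.cyclic_link_axioms)

lemma T2_link: "cyclic_link 12 T2 [1, 5, 11, 4, 8, 7, 6]" by (rule T2.cyclic_link_axioms)

lemma T1_facts: "cyclic_triangulation 12 T1" "equivelar 7 T1" "orientable T1" "euler_char T1 = - 2"
proof -
  show "cyclic_triangulation 12 T1" "equivelar 7 T1" using T1.cyclic_equivelar by (simp_all add: eval_nat_numeral)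
  show "orientable T1" by (rule T1.orientable_if_parity) auto
  show "euler_char T1 = - 2" using T1.euler_char_eq by simp
qed

lemma T2_facts: "cyclic_triangulation 12 T2" "equivelar 7 T2" "orientable T2" "euler_char T2 = - 2"
proof -
  show "cyclic_triangulation 12 T2" "equivelar 7 T2" using T2.cyclic_equivelar by (simp_all add: eval_nat_numeral)
  show "orientable T2" by (rule T2.orientable_if_parity) auto
  show "euler_char T2 = - 2" using T2.euler_char_eq by simp
qed

text \<open>Non-adjacent vertices of \<open>T1\<close> differ by 3, 5, 7 or 9, so non-adjacency is bipartite there,
  while \<open>0, 2, 4, 6, 9\<close> is a 5-cycle of non-adjacent vertices of \<open>T2\<close>.\<close>
lemma T1_T2_not_iso: "\<not> iso T1 T2"
proof
  assume "iso T1 T2"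
  then obtain f where f: "bij_betw f {0..<12} {0..<12}" "(\<lambda>t. f ` t) ` T1 = T2"
    unfolding iso_def T1.verts_eq T2.verts_eq by blast
  have opp: "even u \<noteq> even v"
    if u: "u < 12" "v < 12" "f u \<noteq> f v" "dif 12 (f u) (f v) \<notin> set [1, 5, 11, 4, 8, 7, 6]" for u v
  proof
    assume "even u = even v"
    have uv: "u \<noteq> v" using u(3) by auto
    have "f u < 12" "f v < 12" using f(1) u(1,2) bij_betwE by fastforce+
    then have "\<not> (\<exists>t\<in>T2. f u \<in> t \<and> f v \<in> t)" using T2.adjacent_iff u(3,4) by blast
    then have "\<not> (\<exists>t\<in>T1. u \<in> t \<and> v \<in> t)" unfolding f(2)[symmetric] by blast
    then have "dif 12 u v \<notin> set [1, 2, 6, 8, 4, 10, 11]" using T1.adjacent_iff[OF u(1,2) uv] by blast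
    moreover have "dif 12 u v < 12" by (simp add: dif_def)
    moreover have "even (dif 12 u v)" using \<open>even u = even v\<close> u(1) unfolding dif_def
      by (simp add: dvd_mod_iff)
    moreover have "dif 12 u v \<noteq> 0" using add_dif_eq[OF u(1,2)] uv u(1) by (cases "dif 12 u v = 0") auto
    ultimately show False by simp presburger
  qed
  have ex: "\<exists>v<12. f v = w" if "w < 12" for w
  proof -
    have "w \<in> f ` {0..<12}" using f(1) that by (simp add: bij_betw_def)
    then show ?thesis by auto
  qed
  obtain v0 where "v0 < 12" "f v0 = 0" using ex[of 0] by auto
  moreover obtain v2 where "v2 < 12" "f v2 = 2" using ex[of 2] by auto
  moreover obtain v4 where "v4 < 12" "f v4 = 4" using ex[of 4] by auto
  moreover obtain v6 where "v6 < 12" "f v6 = 6" using ex[of 6] by auto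
  moreover obtain v9 where "v9 < 12" "f v9 = 9" using ex[of 9] by auto
  ultimately show False using opp[of v0 v2] opp[of v2 v4] opp[of v4 v6] opp[of v6 v9] opp[of v9 v0]
    by (simp add: dif_def)
qed

section \<open>The link of 0 in an arbitrary cyclic triangulation\<close>

lemma card_diff_add: "A \<subseteq> S \<Longrightarrow> finite S \<Longrightarrow> card S = card (S - A) + card A"
  by (metis card_Diff_subset card_mono finite_subset le_add_diff_inverse2)

lemma even_card_involution:
  assumes "finite S" "\<And>x. x \<in> S \<Longrightarrow> h x \<in> S \<and> h (h x) = x \<and> h x \<noteq> x"
  shows "even (card S)"
  using assms
proof (induction S rule: finite_psubset_induct)
  case (psubset S)
  show ?case
  proof (cases "S = {}")
    case False
    then obtain x where x: "x \<in> S" by blast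
    have hx: "h x \<in> S" "h (h x) = x" "h x \<noteq> x" using psubset.prems[OF x] by blast+
    let ?T = "S - {x, h x}"
    have "even (card ?T)"
    proof (rule psubset.IH)
      show "?T \<subset> S" using x by blast
      show "h y \<in> ?T \<and> h (h y) = y \<and> h y \<noteq> y" if "y \<in> ?T" for y
      proof -
        have "h y \<in> S" "h (h y) = y" "h y \<noteq> y" using psubset.prems[of y] that by auto
        moreover have "h y \<noteq> x" "h y \<noteq> h x" using calculation(2) that hx(2) by auto
        ultimately show ?thesis by blast
      qed
    qed
    moreover have "card S = card ?T + card {x, h x}"
      using card_diff_add[of "{x, h x}" S] psubset.hyps x hx(1) by simp
    ultimately show ?thesis using hx(3) by simp
  qed simp
qed

text \<open>Orbits are removed one by one. They have three elements: \<open>h (h x) = x\<close>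
  would give \<open>h x = h (h (h x)) = x\<close>.\<close>

lemma three_dvd_card_rotation:
  assumes "finite S" "\<And>x. x \<in> S \<Longrightarrow> h x \<in> S \<and> h (h (h x)) = x \<and> h x \<noteq> x"
  shows "3 dvd card S"
  using assms
proof (induction S rule: finite_psubset_induct)
  case (psubset S)
  show ?case
  proof (cases "S = {}")
    case False
    then obtain x where x: "x \<in> S" by blast
    have hx: "h x \<in> S" "h (h x) \<in> S" "h (h (h x)) = x" "h x \<noteq> x" "h (h x) \<noteq> h x" "h (h x) \<noteq> x"
      using psubset.prems[OF x] psubset.prems[of "h x"] psubset.prems[of "h (h x)"] by metis+
    let ?T = "S - {x, h x, h (h x)}"
    have "3 dvd card ?T"
    proof (rule psubset.IH)
      show "?T \<subset> S" using x by blast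
      show "h y \<in> ?T \<and> h (h (h y)) = y \<and> h y \<noteq> y" if y: "y \<in> ?T" for y
      proof -
        have "h y \<in> S" "h (h (h y)) = y" "h y \<noteq> y" using psubset.prems[of y] y by auto
        moreover have "h y \<noteq> x" "h y \<noteq> h x" "h y \<noteq> h (h x)"
          using calculation(2) y hx(3) by auto
        ultimately show ?thesis by blast
      qed
    qed
    moreover have "card S = card ?T + card {x, h x, h (h x)}"
      using card_diff_add[of "{x, h x, h (h x)}" S] psubset.hyps x hx(1,2) by simp
    moreover have "card {x, h x, h (h x)} = 3" using hx(4-6) by simp
    ultimately show ?thesis by simp
  qed simp
qed

lemma dif_if: "a < n \<Longrightarrow> b < n \<Longrightarrow> dif n a b = (if a \<le> b then b - a else b + n - a)"
  using dif_le[of a b n] dif_gt[of b a n] by (auto simp: add.commute)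

text \<open>Re-rooting \<open>{0, a, b}\<close> at \<open>a\<close> turns \<open>(a, b)\<close> into
  \<open>(b - a, -a)\<close>, and doing so again gives \<open>(-b, a - b)\<close>.\<close>

lemma dif_rot:
  assumes "0 < a" "a < n" "0 < b" "b < n" "a \<noteq> b"
  shows "0 < dif n a b" "dif n a b < n" "dif n a b \<noteq> n - a" "dif n (dif n a b) (n - a) = n - b"
proof -
  have e: "dif n a b = (if a \<le> b then b - a else b + n - a)"
    using assms by (intro dif_if) auto
  show "0 < dif n a b" "dif n a b < n" "dif n a b \<noteq> n - a" using e assms by auto
  show "dif n (dif n a b) (n - a) = n - b"
  proof (cases "a \<le> b")
    case True
    then show ?thesis using e assms by (subst dif_le) auto
  next
    case False
    then show ?thesis using e assms by (subst dif_gt) auto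
  qed
qed

section \<open>The link of 0 as a connected 2-regular graph\<close>

locale cyclic_surface =
  fixes n :: nat and K :: "nat set set"
  assumes cyc_tri: "cyclic_triangulation n K"
begin

lemma n3: "3 \<le> n" and verts: "cverts K = {0..<n}" and surf: "closed_surface K"
  and shift1: "t \<in> K \<Longrightarrow> shift n 1 ` t \<in> K"
  using cyc_tri unfolding cyclic_triangulation_def by auto

lemma tri_lt: "t \<in> K \<Longrightarrow> x \<in> t \<Longrightarrow> x < n"
  using verts unfolding cverts_def by auto

lemma tri_card: "t \<in> K \<Longrightarrow> card t = 3"
  using surf unfolding closed_surface_def by blast

lemma two_triangles: "e \<in> tri_edges K \<Longrightarrow> card {t \<in> K. e \<subseteq> t} = 2"
  using surf unfolding closed_surface_def by simp

lemma shift_in: "t \<in> K \<Longrightarrow> shift n i ` t \<in> K"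
proof (induction i)
  case 0
  have "shift n 0 ` t = id ` t" using tri_lt[OF 0] by (intro image_cong) (auto simp: shift_def)
  then show ?case using 0 by simp
next
  case (Suc i)
  have "shift n (Suc i) ` t = shift n 1 ` shift n i ` t"
    unfolding image_image by (intro image_cong) (auto simp: shift_def mod_Suc_eq)
  then show ?case using shift1[OF Suc.IH[OF Suc.prems]] by simp
qed

definition R :: "nat \<Rightarrow> nat \<Rightarrow> bool" where
  "R a b \<longleftrightarrow> {0, a, b} \<in> K \<and> a \<noteq> b \<and> 0 < a \<and> 0 < b"

definition D :: "nat set" where "D = {a. \<exists>b. R a b}"

lemma R_sym: "R a b \<Longrightarrow> R b a"
  unfolding R_def by (auto simp: insert_commute)

lemma R_range: "R a b \<Longrightarrow> 0 < a \<and> a < n \<and> 0 < b \<and> b < n \<and> a \<noteq> b"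
  unfolding R_def using tri_lt by auto

lemma R_D: "R a b \<Longrightarrow> a \<in> D \<and> b \<in> D"
  unfolding D_def using R_sym by blast

lemma star_R: "t \<in> K \<and> 0 \<in> t \<longleftrightarrow> (\<exists>a b. R a b \<and> t = {0, a, b})"
proof
  assume t: "t \<in> K \<and> 0 \<in> t"
  then obtain x y z where xyz: "t = {x, y, z}" "x \<noteq> y" "y \<noteq> z" "x \<noteq> z"
    using tri_card[of t] unfolding card_3_iff by (elim conjE exE) metis
  consider "x = 0" | "y = 0" | "z = 0" using t xyz(1) by auto
  then have "\<exists>a b. t = {0, a, b} \<and> a \<noteq> b \<and> 0 < a \<and> 0 < b"
  proof cases
    case 1 then show ?thesis using xyz by (intro exI[of _ y] exI[of _ z]) simp
  next
    case 2 then show ?thesis using xyz by (intro exI[of _ x] exI[of _ z]) (simp add: insert_commute)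
  next
    case 3 then show ?thesis using xyz by (intro exI[of _ x] exI[of _ y]) (simp add: insert_commute)
  qed
  then show "\<exists>a b. R a b \<and> t = {0, a, b}" using t unfolding R_def by metis
next
  assume "\<exists>a b. R a b \<and> t = {0, a, b}"
  then show "t \<in> K \<and> 0 \<in> t" unfolding R_def by auto
qed

text \<open>Moving a vertex of a triangle to 0 and back shows that the link of 0 determines the
  whole complex.\<close>

lemma K_rep: "t \<in> K \<longleftrightarrow> (\<exists>v<n. \<exists>a b. R a b \<and> t = {v, (v + a) mod n, (v + b) mod n})"
proof
  assume t: "t \<in> K"
  then obtain v where v: "v \<in> t" using tri_card by fastforce
  then have vn: "v < n" using tri_lt[OF t] by blast
  have "0 \<in> shift n (n - v) ` t" using v vn by (intro image_eqI[of _ _ v]) (auto simp: shift_def)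
  then obtain a b where ab: "R a b" "shift n (n - v) ` t = {0, a, b}"
    using shift_in[OF t] star_R by blast
  have "shift n v ` shift n (n - v) ` t = id ` t"
    unfolding image_image
  proof (intro image_cong)
    fix x assume "x \<in> t"
    then have "x < n" using tri_lt[OF t] by blast
    moreover have "x + (n - v) + v = x + n" using vn by simp
    ultimately show "shift n v (shift n (n - v) x) = id x"
      unfolding shift_def mod_add_left_eq by simp
  qed simp
  then have "t = {v, (v + a) mod n, (v + b) mod n}"
    unfolding ab(2) using vn by (simp add: shift_def add.commute)
  then show "\<exists>v<n. \<exists>a b. R a b \<and> t = {v, (v + a) mod n, (v + b) mod n}" using ab(1) vn by blast
next
  assume "\<exists>v<n. \<exists>a b. R a b \<and> t = {v, (v + a) mod n, (v + b) mod n}"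
  then obtain v a b where h: "v < n" "R a b" "t = {v, (v + a) mod n, (v + b) mod n}" by blast
  then have "shift n v ` {0, a, b} = t" by (simp add: shift_def add.commute)
  moreover have "{0, a, b} \<in> K" using h(2) unfolding R_def by simp
  ultimately show "t \<in> K" using shift_in by metis
qed

text \<open>The translate of \<open>{0, a, b}\<close> by \<open>-a\<close> contains 0 again and so
  yields another edge of the same link.\<close>

lemma R_rot: "R a b \<Longrightarrow> R (dif n a b) (n - a)"
proof -
  assume ab: "R a b"
  note r = R_range[OF ab]
  have "shift n (n - a) ` {0, a, b} = {0, dif n a b, n - a}"
    using r by (auto simp: shift_def dif_def add.commute)
  moreover have "{0, a, b} \<in> K" using ab unfolding R_def by simp
  ultimately have "{0, dif n a b, n - a} \<in> K" using shift_in by metis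
  then show ?thesis unfolding R_def using r dif_rot(1,3)[of a n b] by auto
qed

lemma D_neg: "a \<in> D \<Longrightarrow> n - a \<in> D"
  unfolding D_def using R_rot R_sym by blast

lemma D_range: "a \<in> D \<Longrightarrow> 0 < a \<and> a < n"
  unfolding D_def using R_range by blast

lemma finite_D: "finite D"
  using D_range by (intro finite_subset[of D "{0..<n}"]) auto

text \<open>Neighbours of \<open>a\<close> in the link correspond to the triangles over the edge
  \<open>{0, a}\<close>.\<close>

lemma degree: "a \<in> D \<Longrightarrow> card {b. R a b} = 2"
proof -
  assume "a \<in> D"
  then obtain b where ab: "R a b" unfolding D_def by blast
  note r = R_range[OF ab]
  have "{0, a, b} \<in> K" using ab unfolding R_def by simp
  then have "{0, a} \<in> tri_edges K" unfolding tri_edges_def using r by auto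
  then have "card {t \<in> K. {0, a} \<subseteq> t} = 2" by (rule two_triangles)
  moreover have "bij_betw (\<lambda>b. {0, a, b}) {b. R a b} {t \<in> K. {0, a} \<subseteq> t}"
  proof (rule bij_betwI')
    fix x y assume "x \<in> {b. R a b}" "y \<in> {b. R a b}"
    then have "x \<noteq> 0" "x \<noteq> a" "y \<noteq> 0" "y \<noteq> a" using R_range by blast+
    moreover have "x \<in> {0, a, y}" if "{0, a, x} = {0, a, y}" unfolding that[symmetric] by simp
    ultimately show "({0, a, x} = {0, a, y}) = (x = y)" by blast
  next
    fix x assume "x \<in> {b. R a b}"
    then show "{0, a, x} \<in> {t \<in> K. {0, a} \<subseteq> t}" unfolding R_def by simp
  next
    fix t assume "t \<in> {t \<in> K. {0, a} \<subseteq> t}"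
    then have "t \<in> K \<and> 0 \<in> t" "a \<in> t" by auto
    then obtain x y where xy: "R x y" "t = {0, x, y}" using star_R by blast
    then have "a = x \<or> a = y" using \<open>a \<in> t\<close> r by auto
    then show "\<exists>x\<in>{b. R a b}. t = {0, a, x}"
      using xy R_sym[OF xy(1)] by (auto simp: insert_commute)
  qed
  ultimately show ?thesis using bij_betw_same_card by fastforce
qed

lemma two_neighbours: "R a b \<Longrightarrow> R a c \<Longrightarrow> b \<noteq> c \<Longrightarrow> R a d \<Longrightarrow> d = b \<or> d = c"
proof -
  assume h: "R a b" "R a c" "b \<noteq> c" "R a d"
  have "card {b. R a b} = 2" using degree R_D[OF h(1)] by blast
  then obtain p q where "{b. R a b} = {p, q}" unfolding card_2_iff by blast
  then have "b \<in> {p, q}" "c \<in> {p, q}" "d \<in> {p, q}" using h by blast+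
  then show ?thesis using h(3) by auto
qed

lemma other_neighbour: "a \<in> D \<Longrightarrow> \<exists>c. R a c \<and> c \<noteq> b"
proof -
  assume "a \<in> D"
  then have "card {b. R a b} = 2" by (rule degree)
  then obtain p q where "{b. R a b} = {p, q}" "p \<noteq> q" unfolding card_2_iff by blast
  then have "R a p" "R a q" "p \<noteq> q" by blast+
  then show ?thesis by metis
qed

text \<open>Connectedness of the link in the form of an induction principle, used to show that a
  walk on the link has met every vertex.\<close>

lemma R_connected:
  assumes "x \<in> X" "x \<in> D" "\<And>a b. a \<in> X \<Longrightarrow> R a b \<Longrightarrow> b \<in> X"
  shows "D \<subseteq> X"
proof
  fix y assume "y \<in> D"
  have le: "{a, b} \<in> link_edges K 0 \<longleftrightarrow> R a b" for a b
  proof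
    assume "{a, b} \<in> link_edges K 0"
    then obtain t where t: "t \<in> K \<and> 0 \<in> t" "{a, b} = t - {0}" unfolding link_edges_def by blast
    obtain p q where pq: "R p q" "t = {0, p, q}" using t(1) star_R by blast
    then have "{a, b} = {p, q}" using t(2) R_range[OF pq(1)] by auto
    then show "R a b" using pq(1) R_sym by (auto simp: doubleton_eq_iff)
  next
    assume "R a b"
    then have "{0, a, b} \<in> K \<and> 0 \<in> {0, a, b}" "{0, a, b} - {0} = {a, b}" unfolding R_def by auto
    then show "{a, b} \<in> link_edges K 0" unfolding link_edges_def by (metis (mono_tags, lifting) mem_Collect_eq)
  qed
  have U: "z \<in> \<Union>(link_edges K 0)" if "z \<in> D" for z
  proof -
    from that obtain b where "R z b" unfolding D_def by blast
    then show ?thesis using le[of z b] by blast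
  qed
  have "0 \<in> cverts K" using verts n3 by simp
  then have "link_connected K 0" using surf unfolding closed_surface_def by blast
  then have "(\<lambda>a b. {a, b} \<in> link_edges K 0)\<^sup>*\<^sup>* x y"
    unfolding link_connected_def using U assms(2) \<open>y \<in> D\<close> by blast
  then have "R\<^sup>*\<^sup>* x y" unfolding le .
  then show "y \<in> X" by (induction rule: rtranclp_induct) (use assms in auto)
qed

text \<open>Every edge stays within a residue class modulo \<open>d\<close>, while connectedness
  joins 0 to 1.\<close>

lemma gcd_D: assumes "d dvd n" "\<And>a. a \<in> D \<Longrightarrow> d dvd a" shows "d = 1"
proof -
  have step: "a mod d = b mod d" if "{a, b} \<in> tri_edges K" for a b
  proof -
    from that obtain t where t: "t \<in> K" "a \<in> t" "b \<in> t" unfolding tri_edges_def by blast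
    obtain v x y where v: "R x y" "t = {v, (v + x) mod n, (v + y) mod n}" "v < n"
      using iffD1[OF K_rep t(1)] by (elim exE conjE)
    have "d dvd x" "d dvd y" using assms(2) R_D[OF v(1)] by blast+
    then have "(v + x) mod n mod d = v mod d" "(v + y) mod n mod d = v mod d"
      using assms(1) by (metis mod_mod_cancel mod_add_right_eq add_0_right dvd_imp_mod_0)+
    then have "z mod d = v mod d" if "z \<in> t" for z using v(2) that by auto
    then show ?thesis using t by metis
  qed
  have "skeleton_connected K" using surf unfolding closed_surface_def by blast
  then have "(\<lambda>a b. {a, b} \<in> tri_edges K)\<^sup>*\<^sup>* 0 1"
    unfolding skeleton_connected_def verts using n3 by simp
  then have "0 mod d = 1 mod d" by (induction rule: rtranclp_induct) (use step in auto)
  then show ?thesis by (cases "d = 1") auto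
qed

end

text \<open>Multiplication by \<open>u\<close> is its own inverse modulo \<open>n\<close>, so
  preserving link edges in both directions is enough.\<close>

lemma iso_mult:
  assumes rK: "\<And>t. t \<in> K \<longleftrightarrow> (\<exists>v<n. \<exists>a b. R a b \<and> t = {v, (v + a) mod n, (v + b) mod n})"
    and rL: "\<And>t. t \<in> L \<longleftrightarrow> (\<exists>v<n. \<exists>a b. Q a b \<and> t = {v, (v + a) mod n, (v + b) mod n})"
    and vK: "cverts K = {0..<n}" and vL: "cverts L = {0..<n}"
    and u: "u * u mod n = (1::nat)"
    and RQ: "\<And>a b. R a b \<Longrightarrow> Q (u * a mod n) (u * b mod n)"
    and QR: "\<And>a b. Q a b \<Longrightarrow> R (u * a mod n) (u * b mod n)"
  shows "iso K L"
proof -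
  define f where "f x = u * x mod n" for x
  \<comment> \<open>Stated for arbitrary complexes and relations because it is applied once in each
    direction.\<close>
  have im: "f ` t \<in> L'" if "t \<in> K'"
    and "\<And>t. t \<in> K' \<longleftrightarrow> (\<exists>v<n. \<exists>a b. R' a b \<and> t = {v, (v + a) mod n, (v + b) mod n})"
    and "\<And>t. t \<in> L' \<longleftrightarrow> (\<exists>v<n. \<exists>a b. Q' a b \<and> t = {v, (v + a) mod n, (v + b) mod n})"
    and "\<And>a b. R' a b \<Longrightarrow> Q' (u * a mod n) (u * b mod n)" for K' L' R' Q' t
  proof -
    note h0 = that
    obtain v a b where h: "v < n" "R' a b" "t = {v, (v + a) mod n, (v + b) mod n}"
      using iffD1[OF h0(2) h0(1)] by (elim exE conjE)
    have m: "f ((v + z) mod n) = (f v + u * z mod n) mod n" for z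
      unfolding f_def by (simp add: mod_mult_right_eq mod_add_eq distrib_left)
    have "f ` t = {f v, (f v + u * a mod n) mod n, (f v + u * b mod n) mod n}"
      unfolding h(3) by (simp add: m)
    moreover have "f v < n" using h(1) by (simp add: f_def)
    ultimately show ?thesis
      by (intro iffD2[OF h0(3)] exI conjI, use h0(4)[OF h(2)] in simp_all)
  qed
  have ff: "f (f x) = x" if "x < n" for x
  proof -
    have "f (f x) = (u * u mod n) * x mod n"
      unfolding f_def by (simp add: mod_mult_left_eq mod_mult_right_eq mult.assoc)
    then show ?thesis using u that by simp
  qed
  have bij: "bij_betw f {0..<n} {0..<n}"
    by (rule bij_betw_byWitness[where f' = f]) (auto simp: ff, auto simp: f_def)
  have "t \<in> (\<lambda>t. f ` t) ` K" if "t \<in> L" for t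
  proof -
    have "f ` t \<in> K" using im[OF that rL rK QR] .
    moreover have "f ` f ` t = t"
    proof -
      have "t \<subseteq> {0..<n}" using that vL unfolding cverts_def by blast
      then have "f ` f ` t = id ` t" unfolding image_image
        by (intro image_cong) (auto simp: ff)
      then show ?thesis by simp
    qed
    ultimately show ?thesis by (metis imageI)
  qed
  moreover have "f ` t \<in> L" if "t \<in> K" for t using im[OF that rK rL RQ] .
  ultimately have "(\<lambda>t. f ` t) ` K = L" by blast
  then show ?thesis unfolding iso_def vK vL using bij by blast
qed

section \<open>The size of the link, and the residues \<open>n/2\<close> and \<open>n/3\<close> in
  it\<close>

context cyclic_surface
begin

text \<open>Double counting in the star of 0: a triangle there has two link vertices, and a link
  vertex lies in two of these triangles.\<close>

lemma card_D:
  assumes "equivelar q K"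
  shows "card D = q"
proof -
  let ?S = "{t \<in> K. 0 \<in> t}"
  have "K \<subseteq> Pow {0..<n}" using tri_lt by auto
  then have fin: "finite ?S" by (intro finite_subset[of ?S "Pow {0..<n}"]) auto
  have deg: "card {t \<in> ?S. a \<in> t} = 2" if "a \<in> D" for a
  proof -
    from that obtain b where ab: "R a b" unfolding D_def by blast
    have "{0, a, b} \<in> K" "0 < a" "a \<noteq> b" using ab unfolding R_def by auto
    then have "{0, a} \<in> tri_edges K" unfolding tri_edges_def by auto
    then have "card {t \<in> K. {0, a} \<subseteq> t} = 2" by (rule two_triangles)
    moreover have "{t \<in> K. {0, a} \<subseteq> t} = {t \<in> ?S. a \<in> t}" by auto
    ultimately show ?thesis by simp
  qed
  then have "(\<Sum>t\<in>?S. card {a \<in> D. a \<in> t}) = 2 * card D"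
    using fin finite_D by (intro sum_multicount) auto
  moreover have "card {a \<in> D. a \<in> t} = 2" if "t \<in> ?S" for t
  proof -
    from that have t: "t \<in> K \<and> 0 \<in> t" by simp
    obtain a b where ab: "R a b" "t = {0, a, b}" using iffD1[OF star_R t] by (elim exE conjE)
    have "0 \<notin> D" using D_range by blast
    then have "{a \<in> D. a \<in> t} = {a, b}" using ab R_D[OF ab(1)] by auto
    then show ?thesis using R_range[OF ab(1)] by simp
  qed
  then have "(\<Sum>t\<in>?S. card {a \<in> D. a \<in> t}) = (\<Sum>t\<in>?S. 2)" by (rule sum.cong[OF refl])
  ultimately have "2 * card ?S = 2 * card D" by simp
  moreover have "card ?S = q" using assms verts n3 unfolding equivelar_def by simp
  ultimately show ?thesis by simp
qed

lemma card_pairs: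
  assumes "equivelar q K"
  shows "card {(a, b). R a b} = 2 * q" "finite {(a, b). R a b}"
proof -
  have eq: "{(a, b). R a b} = Sigma D (\<lambda>a. {b. R a b})" unfolding D_def by auto
  have fin: "finite {b. R a b}" for a
    using finite_D R_D by (intro finite_subset[of "{b. R a b}" D]) auto
  have "card (Sigma D (\<lambda>a. {b. R a b})) = (\<Sum>a\<in>D. card {b. R a b})"
    using finite_D fin by (intro card_SigmaI) auto
  also have "\<dots> = (\<Sum>a\<in>D. 2)" using degree by (rule sum.cong[OF refl])
  also have "\<dots> = 2 * q" using card_D[OF assms] by simp
  finally show "card {(a, b). R a b} = 2 * q" unfolding eq .
  show "finite {(a, b). R a b}" unfolding eq using finite_D fin by (rule finite_SigmaI)
qed

text \<open>Negation acts on the \<open>q\<close> link vertices; as \<open>q\<close> is odd it has a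
  fixed point, which must be \<open>n/2\<close>.\<close>

lemma half_in_D:
  assumes "equivelar q K" "odd q"
  obtains c where "n = 2 * c" "c \<in> D"
proof -
  have "\<exists>a\<in>D. n - a = a"
  proof (rule ccontr)
    assume "\<not> (\<exists>a\<in>D. n - a = a)"
    then have "n - a \<in> D \<and> n - (n - a) = a \<and> n - a \<noteq> a" if "a \<in> D" for a
      using that D_neg D_range[OF that] by auto
    then have "even (card D)" using even_card_involution[of D "\<lambda>a. n - a"] finite_D by blast
    then show False using card_D[OF assms(1)] assms(2) by simp
  qed
  then obtain a where a: "a \<in> D" "n - a = a" by blast
  then have "n = 2 * a" using D_range[of a] by simp
  then show thesis using that a(1) by blast
qed

text \<open>A fixed point of the rotation of ordered link edges is a triangle of the form
  \<open>{0, n/3, 2n/3}\<close>.\<close>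
lemma third_in_R:
  assumes "equivelar q K" "\<not> 3 dvd q"
  obtains t where "n = 3 * t" "R t (2 * t)"
proof -
  let ?P = "{(a, b). R a b}" and ?h = "\<lambda>(a, b). (dif n a b, n - a)"
  have "\<exists>p\<in>?P. ?h p = p"
  proof (rule ccontr)
    assume no: "\<not> (\<exists>p\<in>?P. ?h p = p)"
    \<comment> \<open>Three rotations re-root the triangle at each of its vertices and return to the
      start.\<close>
    have "?h p \<in> ?P \<and> ?h (?h (?h p)) = p \<and> ?h p \<noteq> p" if "p \<in> ?P" for p
    proof -
      obtain a b where p: "p = (a, b)" by (cases p)
      then have ab: "R a b" using that by simp
      note r = R_range[OF ab]
      have e1: "?h p = (dif n a b, n - a)" using p by simp
      have f: "dif n (dif n a b) (n - a) = n - b" using dif_rot(4)[of a n b] r by simp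
      have "dif n (n - b) (n - dif n a b) = n - (n - a)"
        using dif_rot(4)[of "dif n a b" n "n - a"] dif_rot(1-4)[of a n b] r by simp
      then have e3: "?h (?h (?h p)) = p" unfolding p using r f by simp
      have "?h p \<in> ?P" unfolding e1 using R_rot[OF ab] by simp
      then show ?thesis using e3 no that by blast
    qed
    then have "3 dvd card ?P"
      using three_dvd_card_rotation[of ?P ?h] card_pairs(2)[OF assms(1)] by blast
    then have "3 dvd 2 * q" unfolding card_pairs(1)[OF assms(1)] .
    then show False using assms(2) by presburger
  qed
  then obtain a b where ab: "R a b" "dif n a b = a" "n - a = b" by auto
  note r = R_range[OF ab(1)]
  have "(if a \<le> b then b - a else b + n - a) = a" using dif_if[of a n b] ab(2) r by simp
  \<comment> \<open>The fixed pair is \<open>(n/3, 2n/3)\<close> or its reverse.\<close>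
  then consider "n = 3 * a" "b = 2 * a" | "n = 3 * b" "a = 2 * b"
    using ab(3) r by (cases "a \<le> b") auto
  then show thesis
  proof cases
    case 1 then show ?thesis using that ab(1) by blast
  next
    case 2 then show ?thesis using that R_sym[OF ab(1)] by blast
  qed
qed

end

section \<open>Classification in degree 7\<close>

locale seven_equivelar = cyclic_surface +
  assumes seven: "equivelar 7 K"
begin

lemma D7: "card D = 7" using card_D[OF seven] .

text \<open>A walk along the link from the edge \<open>{2 * m, 4 * m}\<close>. Re-rooting
  \<open>{0, 2 * m, w}\<close> at \<open>2 * m\<close> shows that \<open>s\<close>, which is
  \<open>w - 2 * m\<close> modulo \<open>n\<close>, is the other neighbour of \<open>4 * m\<close>;
  the third link edge of this triangle is \<open>{-w, -s}\<close>.\<close>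

lemma cycle:
  obtains m w s x y z where "n = 6 * m" "3 * m \<in> D"
    "distinct [w, 2 * m, 4 * m, s, x, y, z]" "D = {w, 2 * m, 4 * m, s, x, y, z}"
    "s = (if 2 * m \<le> w then w - 2 * m else w + 4 * m)" "R (n - w) (n - s)"
    "R w (2 * m)" "R (2 * m) (4 * m)" "R (4 * m) s" "R s x" "R x y" "R y z" "R z w"
proof -
  obtain t where t: "n = 3 * t" "R t (2 * t)" using third_in_R[OF seven] by auto
  obtain c where c: "n = 2 * c" "c \<in> D" using half_in_D[OF seven] by auto
  \<comment> \<open>From \<open>n = 3 * t\<close> and \<open>n = 2 * c\<close> the difference
    \<open>c - t\<close> is \<open>n/6\<close>.\<close>
  define m where "m = c - t"
  have m: "n = 6 * m" "t = 2 * m" "c = 3 * m" using t(1) c(1) unfolding m_def by linarith+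
  have m0: "0 < m" using n3 m by simp
  have R1: "R (2 * m) (4 * m)" using t(2) m by simp
  obtain w where w: "R (2 * m) w" "w \<noteq> 4 * m" using other_neighbour R_D[OF R1] by blast
  note rw = R_range[OF w(1)]
  define s where "s = (if 2 * m \<le> w then w - 2 * m else w + 4 * m)"
  have dw: "dif n (2 * m) w = s" using dif_if[of "2 * m" n w] rw m by (simp add: s_def)
  have sR: "R s (4 * m)" using R_rot[OF w(1)] unfolding dw using m by simp
  note rs = R_range[OF sR]
  have sne: "s \<noteq> 2 * m" "s \<noteq> w" "s \<noteq> 4 * m" using w(2) rw m m0 by (auto simp: s_def split: if_splits)
  have "dif n s (4 * m) = n - w" using dif_rot(4)[of "2 * m" n w] rw dw m by simp
  then have opp: "R (n - w) (n - s)" using R_rot[OF sR] by simp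
  obtain x where x: "R s x" "x \<noteq> 4 * m" using other_neighbour R_D[OF sR] by blast
  have n2: "d = 4 * m \<or> d = w" if "R (2 * m) d" for d
    using two_neighbours[OF R1 w(1) w(2)[symmetric] that] .
  have n4: "d = 2 * m \<or> d = s" if "R (4 * m) d" for d
    using two_neighbours[OF R_sym[OF R1] R_sym[OF sR] sne(1)[symmetric] that] .
  have ns: "d = 4 * m \<or> d = x" if "R s d" for d
    using two_neighbours[OF sR x(1) x(2)[symmetric] that] .
  \<comment> \<open>Excludes an early return of the walk: fewer than seven points closed under
    adjacency would exhaust \<open>D\<close>.\<close>
  have closed: False if "2 * m \<in> set X" "\<And>a b. a \<in> set X \<Longrightarrow> R a b \<Longrightarrow> b \<in> set X" "length X < 7" for X
  proof -
    have "D \<subseteq> set X" using R_connected[OF that(1)] R_D[OF R1] that(2) by blast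
    then have "card D \<le> length X" using card_mono[of "set X" D] card_length[of X] by simp
    then show False using D7 that(3) by simp
  qed
  have xne: "x \<noteq> s" "x \<noteq> 4 * m" "x \<noteq> 2 * m"
    using R_range[OF x(1)] x(2) sne n2[of s] R_sym[OF x(1)] by auto
  have xw: "x \<noteq> w"
  proof
    assume "x = w"
    then have nw: "d = 2 * m \<or> d = s" if "R w d" for d
      using two_neighbours[OF R_sym[OF w(1)] _ sne(1)[symmetric] that] R_sym[OF x(1)] by blast
    have "b \<in> set [2 * m, 4 * m, s, w]" if "a \<in> set [2 * m, 4 * m, s, w]" "R a b" for a b
      using that n2[of b] n4[of b] ns[of b] nw[of b] \<open>x = w\<close> by auto
    then show False using closed[of "[2 * m, 4 * m, s, w]"] by simp
  qed
  obtain y where y: "R x y" "y \<noteq> s" using other_neighbour R_D[OF x(1)] by blast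
  have nx: "d = s \<or> d = y" if "R x d" for d
    using two_neighbours[OF R_sym[OF x(1)] y(1) y(2)[symmetric] that] .
  have yne: "y \<noteq> x" "y \<noteq> s" "y \<noteq> 4 * m" "y \<noteq> 2 * m"
    using R_range[OF y(1)] y(2) n2[of x] n4[of x] R_sym[OF y(1)] xne xw by auto
  have yw: "y \<noteq> w"
  proof
    assume "y = w"
    then have nw: "d = 2 * m \<or> d = x" if "R w d" for d
      using two_neighbours[OF R_sym[OF w(1)] _ xne(3)[symmetric] that] R_sym[OF y(1)] by blast
    have "b \<in> set [2 * m, 4 * m, s, x, w]" if "a \<in> set [2 * m, 4 * m, s, x, w]" "R a b" for a b
      using that n2[of b] n4[of b] ns[of b] nx[of b] nw[of b] \<open>y = w\<close> by auto
    then show False using closed[of "[2 * m, 4 * m, s, x, w]"] by simp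
  qed
  obtain z where z: "R y z" "z \<noteq> x" using other_neighbour R_D[OF y(1)] by blast
  have ny: "d = x \<or> d = z" if "R y d" for d
    using two_neighbours[OF R_sym[OF y(1)] z(1) z(2)[symmetric] that] .
  have zne: "z \<noteq> y" "z \<noteq> x" "z \<noteq> s" "z \<noteq> 4 * m" "z \<noteq> 2 * m"
    using R_range[OF z(1)] z(2) n2[of y] n4[of y] ns[of y] R_sym[OF z(1)] yne yw by auto
  have zw: "z \<noteq> w"
  proof
    assume "z = w"
    then have nw: "d = 2 * m \<or> d = y" if "R w d" for d
      using two_neighbours[OF R_sym[OF w(1)] _ yne(4)[symmetric] that] R_sym[OF z(1)] by blast
    have "b \<in> set [2 * m, 4 * m, s, x, y, w]" if "a \<in> set [2 * m, 4 * m, s, x, y, w]" "R a b" for a b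
      using that n2[of b] n4[of b] ns[of b] nx[of b] ny[of b] nw[of b] \<open>z = w\<close> by auto
    then show False using closed[of "[2 * m, 4 * m, s, x, y, w]"] by simp
  qed
  let ?X = "{w, 2 * m, 4 * m, s, x, y, z}"
  have dist: "distinct [w, 2 * m, 4 * m, s, x, y, z]"
    using rw rs w(2) sne xne xw yne yw zne zw m0 by auto
  have sub: "?X \<subseteq> D" using R_D[OF R1] R_D[OF w(1)] R_D[OF sR] R_D[OF x(1)] R_D[OF y(1)] R_D[OF z(1)] by auto
  have "card ?X = 7" using distinct_card[OF dist] by simp
  then have DX: "D = ?X" using card_subset_eq[OF finite_D sub] D7 by simp
  \<comment> \<open>The second neighbour of \<open>z\<close> must be \<open>w\<close>, since the
    other points already have both neighbours.\<close>
  obtain v where v: "R z v" "v \<noteq> y" using other_neighbour R_D[OF z(1)] by blast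
  have "v \<in> ?X" using R_D[OF v(1)] DX by blast
  moreover have "v \<noteq> z" using R_range[OF v(1)] by simp
  moreover have "v \<noteq> 2 * m" "v \<noteq> 4 * m" "v \<noteq> s" "v \<noteq> x"
    using n2[of z] n4[of z] ns[of z] nx[of z] R_sym[OF v(1)] zne zw yne by auto
  ultimately have "v = w" using v(2) by auto
  then have "R z w" using v(1) by simp
  have "3 * m \<in> D" using c(2) m(3) by simp
  then show thesis
    using m(1) dist DX s_def opp R_sym[OF w(1)] R1 R_sym[OF sR] x(1) y(1) z(1) \<open>R z w\<close>
    by (intro that[of m w s x y z])
qed

end

lemma cyc7: "cyc [a, b, c, d, e, f, g] = {(a, b), (b, c), (c, d), (d, e), (e, f), (f, g), (g, a)}"
  by (simp add: cyc_arcs) blast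

context seven_equivelar
begin

text \<open>The cases are the positions of \<open>3 * m\<close> on the cycle: \<open>w\<close>,
  \<open>s\<close>, \<open>z\<close> and \<open>x\<close> survive, \<open>y\<close> does not. In
  each surviving case a further rotation gives an equation modulo \<open>6 * m\<close> that leaves
  two solutions, differing by \<open>3 * m\<close>.\<close>

lemma link_cases:
  obtains m w s x y z where "0 < m" "n = 6 * m" "D = {w, 2 * m, 4 * m, s, x, y, z}"
    "\<forall>a b. R a b \<longleftrightarrow> (a, b) \<in> cyc [w, 2 * m, 4 * m, s, x, y, z] \<or> (b, a) \<in> cyc [w, 2 * m, 4 * m, s, x, y, z]"
    "w = 3 * m \<and> s = m \<and> z = 5 * m \<and> y = 6 * m - x \<and> (2 * x = m \<or> 2 * x = 7 * m) \<or>
     w = 5 * m \<and> s = 3 * m \<and> x = m \<and> z = 6 * m - y \<and> (2 * y = m \<or> 2 * y = 7 * m) \<or>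
     s = w - 2 * m \<and> z = 3 * m \<and> x = 6 * m - w \<and> y = 6 * m - s \<and> (2 * w = 5 * m \<or> 2 * w = 11 * m) \<or>
     s = w - 2 * m \<and> x = 3 * m \<and> y = 6 * m - w \<and> z = 6 * m - s \<and> (2 * w = 5 * m \<or> 2 * w = 11 * m)"
proof -
  obtain m w s x y z where n: "n = 6 * m" and cD: "3 * m \<in> D"
    and dist: "distinct [w, 2 * m, 4 * m, s, x, y, z]" and DX: "D = {w, 2 * m, 4 * m, s, x, y, z}"
    and s: "s = (if 2 * m \<le> w then w - 2 * m else w + 4 * m)" and opp: "R (n - w) (n - s)"
    and R: "R w (2 * m)" "R (2 * m) (4 * m)" "R (4 * m) s" "R s x" "R x y" "R y z" "R z w"
    by (rule cycle)
  have m0: "0 < m" using n3 n by simp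
  note r = R_range[OF R(4)] R_range[OF R(6)] R_range[OF R(7)]
  have lt: "w < 6 * m" "s < 6 * m" "x < 6 * m" "y < 6 * m" "z < 6 * m"
    "0 < w" "0 < s" "0 < x" "0 < y" "0 < z" using r unfolding n by simp_all
  have nw: "d = 2 * m \<or> d = z" if "R w d" for d
    by (rule two_neighbours[OF R(1) R_sym[OF R(7)] _ that]) (use dist in auto)
  have n2: "d = w \<or> d = 4 * m" if "R (2 * m) d" for d
    by (rule two_neighbours[OF R_sym[OF R(1)] R(2) _ that]) (use dist in auto)
  have n4: "d = 2 * m \<or> d = s" if "R (4 * m) d" for d
    by (rule two_neighbours[OF R_sym[OF R(2)] R(3) _ that]) (use dist in auto)
  have ns: "d = 4 * m \<or> d = x" if "R s d" for d
    by (rule two_neighbours[OF R_sym[OF R(3)] R(4) _ that]) (use dist in auto)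
  have nx: "d = s \<or> d = y" if "R x d" for d
    by (rule two_neighbours[OF R_sym[OF R(4)] R(5) _ that]) (use dist in auto)
  have ny: "d = x \<or> d = z" if "R y d" for d
    by (rule two_neighbours[OF R_sym[OF R(5)] R(6) _ that]) (use dist in auto)
  have nz: "d = y \<or> d = w" if "R z d" for d
    by (rule two_neighbours[OF R_sym[OF R(6)] R(7) _ that]) (use dist in auto)
  have Rcyc: "R a b \<longleftrightarrow> (a, b) \<in> cyc [w, 2 * m, 4 * m, s, x, y, z] \<or> (b, a) \<in> cyc [w, 2 * m, 4 * m, s, x, y, z]"
    for a b
  proof
    assume ab: "R a b"
    then have "a \<in> {w, 2 * m, 4 * m, s, x, y, z}" using R_D DX by blast
    then consider "a = w" | "a = 2 * m" | "a = 4 * m" | "a = s" | "a = x" | "a = y" | "a = z" by blast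
    then show "(a, b) \<in> cyc [w, 2 * m, 4 * m, s, x, y, z] \<or> (b, a) \<in> cyc [w, 2 * m, 4 * m, s, x, y, z]"
    proof cases
      case 1
      from nw[OF ab[unfolded 1]] show ?thesis unfolding 1 cyc7 by (elim disjE) simp_all
    next
      case 2
      from n2[OF ab[unfolded 2]] show ?thesis unfolding 2 cyc7 by (elim disjE) simp_all
    next
      case 3
      from n4[OF ab[unfolded 3]] show ?thesis unfolding 3 cyc7 by (elim disjE) simp_all
    next
      case 4
      from ns[OF ab[unfolded 4]] show ?thesis unfolding 4 cyc7 by (elim disjE) simp_all
    next
      case 5
      from nx[OF ab[unfolded 5]] show ?thesis unfolding 5 cyc7 by (elim disjE) simp_all
    next
      case 6
      from ny[OF ab[unfolded 6]] show ?thesis unfolding 6 cyc7 by (elim disjE) simp_all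
    next
      case 7
      from nz[OF ab[unfolded 7]] show ?thesis unfolding 7 cyc7 by (elim disjE) simp_all
    qed
  next
    assume "(a, b) \<in> cyc [w, 2 * m, 4 * m, s, x, y, z] \<or> (b, a) \<in> cyc [w, 2 * m, 4 * m, s, x, y, z]"
    moreover have sub: "cyc [w, 2 * m, 4 * m, s, x, y, z] \<subseteq> {(p, q). R p q}"
      unfolding cyc7 using R by simp
    have "R p q" if "(p, q) \<in> cyc [w, 2 * m, 4 * m, s, x, y, z]" for p q
      using subsetD[OF sub that] by simp
    ultimately show "R a b" using R_sym by metis
  qed
  have rot: "R (if a \<le> b then b - a else b + 6 * m - a) (6 * m - a)" if "R a b" for a b
    using R_rot[OF that] dif_if[of a n b] R_range[OF that] unfolding n by simp
  have r3: "6 * m - 3 * m = 3 * m" "v + 6 * m - 3 * m = v + 3 * m" for v by simp_all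
  have neg: "6 * m - a \<in> {w, 2 * m, 4 * m, s, x, y, z}" if "a \<in> D" for a
    using D_neg[OF that] unfolding n DX by simp
  have inD: "w \<in> D" "s \<in> D" "x \<in> D" "z \<in> D" "y \<in> D" unfolding DX by simp_all
  have ne: "w \<noteq> 2 * m" "w \<noteq> 4 * m" "s \<noteq> 2 * m" "s \<noteq> 4 * m" "x \<noteq> 2 * m" "x \<noteq> 4 * m"
    "y \<noteq> 2 * m" "y \<noteq> 4 * m" "z \<noteq> 2 * m" "z \<noteq> 4 * m" "w \<noteq> s" "w \<noteq> x" "w \<noteq> y" "w \<noteq> z"
    "s \<noteq> x" "s \<noteq> y" "s \<noteq> z" "x \<noteq> y" "x \<noteq> z" "y \<noteq> z" using dist by auto
  \<comment> \<open>Away from \<open>3 * m\<close>, the edge \<open>{-w, -s}\<close> cannot meet the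
    known points \<open>w, 2 * m, 4 * m, s\<close>, so it lies among \<open>x, y, z\<close>.\<close>
  have opposite: "6 * m - w \<in> {x, y, z} \<and> 6 * m - s \<in> {x, y, z} \<and> R (6 * m - w) (6 * m - s)"
    if "w \<noteq> 3 * m" "s \<noteq> 3 * m"
  proof -
    have "6 * m - w \<noteq> s"
    proof
      assume e: "6 * m - w = s"
      then have "6 * m - s = w" using lt by simp
      then have "R s w" using opp unfolding n e by simp
      then show False using ns[of w] ne by auto
    qed
    moreover from this have "6 * m - s \<noteq> w" using lt(1,2) by linarith
    moreover have "6 * m - w \<noteq> w" "6 * m - w \<noteq> 2 * m" "6 * m - w \<noteq> 4 * m"
      using that(1) lt(1) ne(1,2) by linarith+
    moreover have "6 * m - s \<noteq> s" "6 * m - s \<noteq> 2 * m" "6 * m - s \<noteq> 4 * m"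
      using that(2) lt(2) ne(3,4) by linarith+
    ultimately have "6 * m - w \<in> {x, y, z}" "6 * m - s \<in> {x, y, z}"
      using neg[OF inD(1)] neg[OF inD(2)] by blast+
    then show ?thesis using opp unfolding n by blast
  qed
  consider "w = 3 * m" | "s = 3 * m" | "x = 3 * m" | "y = 3 * m" | "z = 3 * m"
    using cD m0 unfolding DX by auto
  then have
    "w = 3 * m \<and> s = m \<and> z = 5 * m \<and> y = 6 * m - x \<and> (2 * x = m \<or> 2 * x = 7 * m) \<or>
     w = 5 * m \<and> s = 3 * m \<and> x = m \<and> z = 6 * m - y \<and> (2 * y = m \<or> 2 * y = 7 * m) \<or>
     s = w - 2 * m \<and> z = 3 * m \<and> x = 6 * m - w \<and> y = 6 * m - s \<and> (2 * w = 5 * m \<or> 2 * w = 11 * m) \<or>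
     s = w - 2 * m \<and> x = 3 * m \<and> y = 6 * m - w \<and> z = 6 * m - s \<and> (2 * w = 5 * m \<or> 2 * w = 11 * m)"
    (is "?A \<or> ?B \<or> ?C \<or> ?E")
  proof cases
    case 1
    have s': "s = m" using s 1 by simp
    have "R (5 * m) (3 * m)" using rot[OF R(1)] 1 m0 by simp
    then have z: "z = 5 * m" using nw[of "5 * m"] R_sym 1 m0 by auto
    have "x \<noteq> 3 * m" "x \<noteq> 2 * m" "x \<noteq> 4 * m" "x \<noteq> m" "x \<noteq> 5 * m" using ne 1 s' z by auto
    then have "6 * m - x \<noteq> 3 * m" "6 * m - x \<noteq> 4 * m" "6 * m - x \<noteq> 2 * m" "6 * m - x \<noteq> 5 * m"
      "6 * m - x \<noteq> m" "6 * m - x \<noteq> x" using lt(3) by linarith+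
    then have y: "y = 6 * m - x" using neg[OF inD(3)] 1 s' z lt by auto
    \<comment> \<open>Rotating \<open>{m, x}\<close> at \<open>m\<close> makes \<open>x - m\<close>
      a neighbour of \<open>z = 5 * m\<close>. It is not \<open>w = 3 * m\<close>, as then
      \<open>x = 4 * m\<close>; hence it is \<open>y = -x\<close>.\<close>
    have "R (if m \<le> x then x - m else x + 6 * m - m) (5 * m)" using rot[OF R(4)] unfolding s' by simp
    then have "(if m \<le> x then x - m else x + 6 * m - m) \<in> {y, w}"
      using nz R_sym z by blast
    then have "2 * x = m \<or> 2 * x = 7 * m" using y 1 lt(3) \<open>x \<noteq> 4 * m\<close> m0 by (elim insertE emptyE; cases "m \<le> x"; simp only: if_True if_False simp_thms not_True_eq_False; linarith)
    then show ?thesis using 1 s' y z by simp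
  next
    case 2
    have w: "w = 5 * m" using s 2 m0 by (cases "2 * m \<le> w"; simp only: if_True if_False simp_thms not_True_eq_False; linarith)
    have "R (m) (3 * m)" using rot[OF R_sym[OF R(3)]] 2 m0 by simp
    then have x: "x = m" using ns[of m] R_sym 2 m0 by auto
    have "y \<noteq> 3 * m" "y \<noteq> 2 * m" "y \<noteq> 4 * m" "y \<noteq> m" "y \<noteq> 5 * m" using ne 2 w x by auto
    then have "6 * m - y \<noteq> 3 * m" "6 * m - y \<noteq> 4 * m" "6 * m - y \<noteq> 2 * m" "6 * m - y \<noteq> 5 * m"
      "6 * m - y \<noteq> m" "6 * m - y \<noteq> y" using lt(4) by linarith+
    then have z: "z = 6 * m - y" using neg[OF inD(5)] 2 w x lt by auto
    \<comment> \<open>Likewise \<open>y - m\<close> is a neighbour of \<open>w = 5 * m\<close>;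
      \<open>2 * m\<close> would give \<open>y = 3 * m = s\<close>, so it is
      \<open>z = -y\<close>.\<close>
    have "R (if m \<le> y then y - m else y + 6 * m - m) (5 * m)" using rot[OF R(5)] unfolding x by simp
    then have "(if m \<le> y then y - m else y + 6 * m - m) \<in> {2 * m, z}"
      using nw R_sym w by blast
    then have "2 * y = m \<or> 2 * y = 7 * m" using z lt(4) \<open>y \<noteq> 3 * m\<close> m0 by (elim insertE emptyE; cases "m \<le> y"; simp only: if_True if_False simp_thms not_True_eq_False; linarith)
    then show ?thesis using 2 w x z by simp
  next
    case 3
    have "w \<noteq> 3 * m" "s \<noteq> 3 * m" using 3 ne by auto
    note o = opposite[OF this]
    have y: "y = (if 3 * m \<le> s then s - 3 * m else s + 3 * m)"
    proof -
      have "R (if 3 * m \<le> s then s - 3 * m else s + 3 * m) (3 * m)"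
        using rot[OF R_sym[OF R(4)]] unfolding 3 r3 .
      then have "(if 3 * m \<le> s then s - 3 * m else s + 3 * m) \<in> {s, y}" using nx R_sym 3 by blast
      then show ?thesis using m0 by (elim insertE emptyE; cases "3 * m \<le> s"; simp only: if_True if_False simp_thms not_True_eq_False; linarith)
    qed
    \<comment> \<open>Otherwise \<open>2 * s = 3 * m\<close> modulo \<open>6 * m\<close>, and
      rotating \<open>{s, 3 * m}\<close> at \<open>s\<close> would make \<open>s\<close> and
      \<open>y\<close> adjacent.\<close>
    have "6 * m - s \<noteq> y"
    proof
      assume e: "6 * m - s = y"
      then have "2 * s = 3 * m \<or> 2 * s = 9 * m" using y lt(1,2) by (cases "3 * m \<le> s"; simp only: if_True if_False simp_thms not_True_eq_False; linarith)
      then have "(if s \<le> 3 * m then 3 * m - s else 3 * m + 6 * m - s) = s" by (elim disjE; cases "s \<le> 3 * m"; simp only: if_True if_False simp_thms not_True_eq_False; linarith)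
      moreover have "R (if s \<le> 3 * m then 3 * m - s else 3 * m + 6 * m - s) (6 * m - s)"
        using rot[OF R(4)] unfolding 3 .
      ultimately have "R s y" unfolding e by (simp only:)
      then show False using ns[of y] ne by auto
    qed
    moreover have "6 * m - s \<noteq> 3 * m" "6 * m - w \<noteq> 3 * m"
      using \<open>s \<noteq> 3 * m\<close> \<open>w \<noteq> 3 * m\<close> lt(1,2) by linarith+
    ultimately have z: "z = 6 * m - s" using o 3 by auto
    moreover have "6 * m - w \<noteq> 6 * m - s" using ne(11) lt(1,2) by linarith
    ultimately have y': "y = 6 * m - w" using o 3 \<open>6 * m - w \<noteq> 3 * m\<close> by auto
    \<comment> \<open>Modulo \<open>6 * m\<close>, \<open>y = s + 3 * m\<close>,
      \<open>y = -w\<close> and \<open>s = w - 2 * m\<close> combine to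
      \<open>2 * w = -m\<close>.\<close>
    have "2 * m \<le> w \<and> (2 * w = 5 * m \<or> 2 * w = 11 * m)" using y y' s lt(1,2) m0
      by (cases "2 * m \<le> w"; cases "3 * m \<le> s"; simp only: if_True if_False simp_thms not_True_eq_False; linarith)
    then show ?thesis using 3 y' z s by simp
  next
    case 4
    have "w \<noteq> 3 * m" "s \<noteq> 3 * m" using 4 ne by auto
    note o = opposite[OF this]
    have "6 * m - s \<noteq> 3 * m" "6 * m - w \<noteq> 3 * m" "6 * m - w \<noteq> 6 * m - s"
      using \<open>s \<noteq> 3 * m\<close> \<open>w \<noteq> 3 * m\<close> ne(11) lt(1,2) by linarith+
    \<comment> \<open>With \<open>3 * m\<close> at \<open>y\<close>, the adjacent points
      \<open>-w\<close> and \<open>-s\<close> would have to be \<open>x\<close> and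
      \<open>z\<close>, which are not neighbours.\<close>
    then have "R x z" using o 4 R_sym by auto
    then show ?thesis using nx[of z] ne by auto
  next
    case 5
    have "w \<noteq> 3 * m" "s \<noteq> 3 * m" using 5 ne by auto
    note o = opposite[OF this]
    \<comment> \<open>The argument for \<open>x = 3 * m\<close> read in the other direction around
      the link, with \<open>w\<close> in place of \<open>s\<close>.\<close>
    have y: "y = (if 3 * m \<le> w then w - 3 * m else w + 3 * m)"
    proof -
      have "R (if 3 * m \<le> w then w - 3 * m else w + 3 * m) (3 * m)"
        using rot[OF R(7)] unfolding 5 r3 .
      then have "(if 3 * m \<le> w then w - 3 * m else w + 3 * m) \<in> {w, y}" using nz R_sym 5 by blast
      then show ?thesis using m0 by (elim insertE emptyE; cases "3 * m \<le> w"; simp only: if_True if_False simp_thms not_True_eq_False; linarith)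
    qed
    have "6 * m - w \<noteq> y"
    proof
      assume e: "6 * m - w = y"
      then have "2 * w = 3 * m \<or> 2 * w = 9 * m" using y lt(1,2) by (cases "3 * m \<le> w"; simp only: if_True if_False simp_thms not_True_eq_False; linarith)
      then have "(if w \<le> 3 * m then 3 * m - w else 3 * m + 6 * m - w) = w" by (elim disjE; cases "w \<le> 3 * m"; simp only: if_True if_False simp_thms not_True_eq_False; linarith)
      moreover have "R (if w \<le> 3 * m then 3 * m - w else 3 * m + 6 * m - w) (6 * m - w)"
        using rot[OF R_sym[OF R(7)]] unfolding 5 .
      ultimately have "R w y" unfolding e by (simp only:)
      then show False using nw[of y] ne by auto
    qed
    moreover have "6 * m - s \<noteq> 3 * m" "6 * m - w \<noteq> 3 * m"
      using \<open>s \<noteq> 3 * m\<close> \<open>w \<noteq> 3 * m\<close> lt(1,2) by linarith+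
    ultimately have x: "x = 6 * m - w" using o 5 by auto
    moreover have "6 * m - w \<noteq> 6 * m - s" using ne(11) lt(1,2) by linarith
    ultimately have y': "y = 6 * m - s" using o 5 \<open>6 * m - s \<noteq> 3 * m\<close> by auto
    have "2 * m \<le> w \<and> (2 * w = 5 * m \<or> 2 * w = 11 * m)" using y y' s lt(1,2) m0
      by (cases "2 * m \<le> w"; cases "3 * m \<le> w"; simp only: if_True if_False simp_thms not_True_eq_False; linarith)
    then show ?thesis using 5 y' x s by simp
  qed
  moreover have "\<forall>a b. R a b \<longleftrightarrow> (a, b) \<in> cyc [w, 2 * m, 4 * m, s, x, y, z] \<or> (b, a) \<in> cyc [w, 2 * m, 4 * m, s, x, y, z]"
    using Rcyc by (intro allI)
  ultimately show thesis by (intro that[OF m0 n DX])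
qed

end

section \<open>Reduction to twelve vertices and eight links\<close>

context seven_equivelar
begin

text \<open>In each case an odd multiple of \<open>m\<close> is even, so \<open>m = 2 * k\<close>.
  Then all link vertices are multiples of \<open>k\<close>, and connectedness forces
  \<open>k = 1\<close>.\<close>

lemma link_lists:
  obtains cs where "n = 12" "\<forall>a b. R a b \<longleftrightarrow> (a, b) \<in> cyc cs \<or> (b, a) \<in> cyc cs"
    "cs \<in> {[6, 4, 8, 2, 1, 11, 10], [6, 4, 8, 2, 7, 5, 10], [10, 4, 8, 6, 2, 1, 11],
      [10, 4, 8, 6, 2, 7, 5], [5, 4, 8, 1, 7, 11, 6], [11, 4, 8, 7, 1, 5, 6],
      [5, 4, 8, 1, 6, 7, 11], [11, 4, 8, 7, 6, 1, 5]}"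
proof -
  obtain m w s x y z where m: "0 < m" "n = 6 * m" and DX: "D = {w, 2 * m, 4 * m, s, x, y, z}"
    and Rcyc: "\<forall>a b. R a b \<longleftrightarrow> (a, b) \<in> cyc [w, 2 * m, 4 * m, s, x, y, z] \<or>
      (b, a) \<in> cyc [w, 2 * m, 4 * m, s, x, y, z]"
    and cases: "w = 3 * m \<and> s = m \<and> z = 5 * m \<and> y = 6 * m - x \<and> (2 * x = m \<or> 2 * x = 7 * m) \<or>
     w = 5 * m \<and> s = 3 * m \<and> x = m \<and> z = 6 * m - y \<and> (2 * y = m \<or> 2 * y = 7 * m) \<or>
     s = w - 2 * m \<and> z = 3 * m \<and> x = 6 * m - w \<and> y = 6 * m - s \<and> (2 * w = 5 * m \<or> 2 * w = 11 * m) \<or>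
     s = w - 2 * m \<and> x = 3 * m \<and> y = 6 * m - w \<and> z = 6 * m - s \<and> (2 * w = 5 * m \<or> 2 * w = 11 * m)"
    by (rule link_cases)
  have "2 * x = m \<or> 2 * x = 7 * m \<or> 2 * y = m \<or> 2 * y = 7 * m \<or> 2 * w = 5 * m \<or> 2 * w = 11 * m"
    using cases by (elim disjE conjE) simp_all
  then have "even m" by (elim disjE; presburger)
  then obtain k where k: "m = 2 * k" by (rule evenE)
  have lists: "[w, 2 * m, 4 * m, s, x, y, z] \<in> (\<lambda>cs. map ((*) k) cs) `
     {[6, 4, 8, 2, 1, 11, 10], [6, 4, 8, 2, 7, 5, 10], [10, 4, 8, 6, 2, 1, 11],
      [10, 4, 8, 6, 2, 7, 5], [5, 4, 8, 1, 7, 11, 6], [11, 4, 8, 7, 1, 5, 6],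
      [5, 4, 8, 1, 6, 7, 11], [11, 4, 8, 7, 6, 1, 5]}"
    using cases unfolding k by (elim disjE conjE) simp_all
  then obtain cs where cs: "[w, 2 * m, 4 * m, s, x, y, z] = map ((*) k) cs"
    "cs \<in> {[6, 4, 8, 2, 1, 11, 10], [6, 4, 8, 2, 7, 5, 10], [10, 4, 8, 6, 2, 1, 11],
      [10, 4, 8, 6, 2, 7, 5], [5, 4, 8, 1, 7, 11, 6], [11, 4, 8, 7, 1, 5, 6],
      [5, 4, 8, 1, 6, 7, 11], [11, 4, 8, 7, 6, 1, 5]}" by (rule imageE)
  have "D = set (map ((*) k) cs)" unfolding cs(1)[symmetric] DX by simp
  then have "k dvd a" if "a \<in> D" for a using that by auto
  then have "k = 1" using m k by (intro gcd_D) auto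
  moreover have "map ((*) 1) cs = cs" by (simp add: map_idI)
  ultimately show thesis using that[of cs] Rcyc cs m(2) k by (simp only: mult_1_right) simp
qed

end

lemma (in cyclic_link) K_rep:
  "t \<in> K \<longleftrightarrow> (\<exists>v<n. \<exists>a b. (a, b) \<in> cyc cs \<and> t = {v, (v + a) mod n, (v + b) mod n})"
proof
  assume t: "t \<in> K"
  then obtain v where v: "v \<in> t" using verts by blast
  then have vn: "v < n" using verts[OF t] by blast
  obtain p where p: "p \<in> cyc cs" "case p of (x, y) \<Rightarrow> t = {v, (v + x) mod n, (v + y) mod n}"
    using iffD1[OF rooted[OF vn] conjI[OF t v]] by (rule bexE)
  obtain a b where "p = (a, b)" by (cases p)
  with p have "(a, b) \<in> cyc cs" "t = {v, (v + a) mod n, (v + b) mod n}" by simp_all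
  then show "\<exists>v<n. \<exists>a b. (a, b) \<in> cyc cs \<and> t = {v, (v + a) mod n, (v + b) mod n}"
    using vn by (intro exI conjI)
next
  assume "\<exists>v<n. \<exists>a b. (a, b) \<in> cyc cs \<and> t = {v, (v + a) mod n, (v + b) mod n}"
  then obtain v a b where h: "v < n" "(a, b) \<in> cyc cs" "t = {v, (v + a) mod n, (v + b) mod n}"
    by (elim exE conjE)
  then have "\<exists>(x, y)\<in>cyc cs. t = {v, (v + x) mod n, (v + y) mod n}" by (intro bexI[of _ "(a, b)"]) simp_all
  from iffD2[OF rooted[OF h(1)] this] show "t \<in> K" ..
qed

text \<open>Swapping \<open>a\<close> and \<open>b\<close> does not change the triangle, so arcs may
  be traded for undirected link edges.\<close>

lemma rep_sym:
  assumes "t \<in> K \<longleftrightarrow> (\<exists>v<n. \<exists>a b. (a, b) \<in> E \<and> t = {v, (v + a) mod n, (v + b) mod n})"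
  shows "t \<in> K \<longleftrightarrow> (\<exists>v<n. \<exists>a b. ((a, b) \<in> E \<or> (b, a) \<in> E) \<and> t = {v, (v + a) mod n, (v + b) mod n})"
  unfolding assms by (metis insert_commute)

lemma (in seven_equivelar) iso_mult_cyc:
  assumes R': "\<forall>a b. R a b \<longleftrightarrow> (a, b) \<in> cyc cs \<or> (b, a) \<in> cyc cs"
    and L: "cyclic_link n L ds" and u: "u * u mod n = 1"
    and img: "\<forall>(a, b)\<in>cyc cs. (u * a mod n, u * b mod n) \<in> cyc ds \<or> (u * b mod n, u * a mod n) \<in> cyc ds"
    and img': "\<forall>(a, b)\<in>cyc ds. (u * a mod n, u * b mod n) \<in> cyc cs \<or> (u * b mod n, u * a mod n) \<in> cyc cs"
  shows "iso K L"
proof -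
  note R = R'[rule_format]
  show ?thesis
  proof (rule iso_mult[OF K_rep rep_sym[OF cyclic_link.K_rep[OF L]] verts cyclic_link.verts_eq[OF L] u])
  show "(u * a mod n, u * b mod n) \<in> cyc ds \<or> (u * b mod n, u * a mod n) \<in> cyc ds" if "R a b" for a b
    using that img unfolding R by fast
  show "R (u * a mod n) (u * b mod n)" if "(a, b) \<in> cyc ds \<or> (b, a) \<in> cyc ds" for a b
    using that img' unfolding R by fast
qed
qed

theorem (in seven_equivelar) classification: "iso K T1 \<or> iso K T2"
proof -
  obtain cs where n: "n = 12" and R: "\<forall>a b. R a b \<longleftrightarrow> (a, b) \<in> cyc cs \<or> (b, a) \<in> cyc cs"
    and cs: "cs \<in> {[6, 4, 8, 2, 1, 11, 10], [6, 4, 8, 2, 7, 5, 10], [10, 4, 8, 6, 2, 1, 11],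
      [10, 4, 8, 6, 2, 7, 5], [5, 4, 8, 1, 7, 11, 6], [11, 4, 8, 7, 1, 5, 6],
      [5, 4, 8, 1, 6, 7, 11], [11, 4, 8, 7, 6, 1, 5]}" by (rule link_lists)
  note i1 = iso_mult_cyc[OF R T1_link[folded n]] and i2 = iso_mult_cyc[OF R T2_link[folded n]]
  from cs show ?thesis
  \<comment> \<open>A unit 1, 5, 7 or 11 modulo 12, each its own inverse, carries the list to the
    link of \<open>T1\<close> or \<open>T2\<close> up to direction and starting point.\<close>
  proof (elim insertE emptyE)
    assume c: "cs = [6, 4, 8, 2, 1, 11, 10]"
    show ?thesis by (rule disjI1, rule i1[of 11]) (simp_all add: c n cyc7)
  next
    assume c: "cs = [6, 4, 8, 2, 7, 5, 10]"
    show ?thesis by (rule disjI1, rule i1[of 5]) (simp_all add: c n cyc7)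
  next
    assume c: "cs = [10, 4, 8, 6, 2, 1, 11]"
    show ?thesis by (rule disjI1, rule i1[of 1]) (simp_all add: c n cyc7)
  next
    assume c: "cs = [10, 4, 8, 6, 2, 7, 5]"
    show ?thesis by (rule disjI1, rule i1[of 7]) (simp_all add: c n cyc7)
  next
    assume c: "cs = [5, 4, 8, 1, 7, 11, 6]"
    show ?thesis by (rule disjI2, rule i2[of 11]) (simp_all add: c n cyc7)
  next
    assume c: "cs = [11, 4, 8, 7, 1, 5, 6]"
    show ?thesis by (rule disjI2, rule i2[of 5]) (simp_all add: c n cyc7)
  next
    assume c: "cs = [5, 4, 8, 1, 6, 7, 11]"
    show ?thesis by (rule disjI2, rule i2[of 7]) (simp_all add: c n cyc7)
  next
    assume c: "cs = [11, 4, 8, 7, 6, 1, 5]"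
    show ?thesis by (rule disjI2, rule i2[of 1]) (simp_all add: c n cyc7)
  qed
qed

theorem mainTheorem1:
  shows
   "(\<forall>q::nat. ((\<exists>k\<ge>2. q = 3 * k) \<or> (\<exists>k\<ge>3. q = 3 * k + 1)) \<longrightarrow>
      (\<exists>S. infinite S \<and>
           (\<forall>K\<in>S. (\<exists>n. cyclic_triangulation n K) \<and> equivelar q K \<and> orientable K) \<and>
           (\<forall>K\<in>S. \<forall>L\<in>S. K \<noteq> L \<longrightarrow> \<not> iso K L)) \<and>
      (\<exists>S. infinite S \<and>
           (\<forall>K\<in>S. (\<exists>n. cyclic_triangulation n K) \<and> equivelar q K \<and> \<not> orientable K) \<and>
           (\<forall>K\<in>S. \<forall>L\<in>S. K \<noteq> L \<longrightarrow> \<not> iso K L)))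
    \<and>
    (let T1 = generated 12 [{0, 1, 2}, {0, 2, 6}, {0, 4, 8}];
         T2 = generated 12 [{0, 1, 5}, {0, 1, 6}, {0, 4, 8}]
     in cyclic_triangulation 12 T1 \<and> equivelar 7 T1 \<and> orientable T1 \<and> euler_char T1 = -2 \<and>
        cyclic_triangulation 12 T2 \<and> equivelar 7 T2 \<and> orientable T2 \<and> euler_char T2 = -2 \<and>
        \<not> iso T1 T2 \<and>
        (\<forall>n K. cyclic_triangulation n K \<and> equivelar 7 K \<longrightarrow> iso K T1 \<or> iso K T2))"
proof (rule conjI, intro allI impI)
  fix q :: nat assume "(\<exists>k\<ge>2. q = 3 * k) \<or> (\<exists>k\<ge>3. q = 3 * k + 1)"
  \<comment> \<open>For even \<open>k\<close> the degrees \<open>3 * k\<close> and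
    \<open>3 * k + 1\<close> are \<open>6 * g + 6\<close> and \<open>6 * g + 13\<close>, for odd
    \<open>k\<close> they are \<open>6 * g + 9\<close> and \<open>6 * g + 10\<close>.\<close>
  then have "\<exists>g. q \<in> {6 * g + 6, 6 * g + 9, 6 * g + 10, 6 * g + 13}"
    unfolding insert_iff empty_iff by presburger
  then obtain g where "q \<in> {6 * g + 6, 6 * g + 9, 6 * g + 10, 6 * g + 13}" by (rule exE)
  then show "(\<exists>S. infinite S \<and>
      (\<forall>K\<in>S. (\<exists>n. cyclic_triangulation n K) \<and> equivelar q K \<and> orientable K) \<and>
      (\<forall>K\<in>S. \<forall>L\<in>S. K \<noteq> L \<longrightarrow> \<not> iso K L)) \<and>
    (\<exists>S. infinite S \<and>
      (\<forall>K\<in>S. (\<exists>n. cyclic_triangulation n K) \<and> equivelar q K \<and> \<not> orientable K) \<and>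
      (\<forall>K\<in>S. \<forall>L\<in>S. K \<noteq> L \<longrightarrow> \<not> iso K L))"
    by (rule families)
next
  have "\<forall>n K. cyclic_triangulation n K \<and> equivelar 7 K \<longrightarrow> iso K T1 \<or> iso K T2"
  proof (intro allI impI)
    fix n K assume h: "cyclic_triangulation n K \<and> equivelar 7 K"
    interpret seven_equivelar n K using h by unfold_locales simp_all
    show "iso K T1 \<or> iso K T2" by (rule classification)
  qed
  then show "let T1 = generated 12 [{0, 1, 2}, {0, 2, 6}, {0, 4, 8}];
         T2 = generated 12 [{0, 1, 5}, {0, 1, 6}, {0, 4, 8}]
     in cyclic_triangulation 12 T1 \<and> equivelar 7 T1 \<and> orientable T1 \<and> euler_char T1 = -2 \<and>
        cyclic_triangulation 12 T2 \<and> equivelar 7 T2 \<and> orientable T2 \<and> euler_char T2 = -2 \<and>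
        \<not> iso T1 T2 \<and>
        (\<forall>n K. cyclic_triangulation n K \<and> equivelar 7 K \<longrightarrow> iso K T1 \<or> iso K T2)"
    unfolding Let_def T1_def[symmetric] T2_def[symmetric]
    using T1_facts T2_facts T1_T2_not_iso by (intro conjI)
qed


end
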